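(* Let $R$ be a commutative ring with $1$ and $M$ an $R$-module. The map $u_M: M \to \mathrm{Mod}(M,R)^c$, $m \mapsto R\cdot m$, is a $u_R$-norm satisfying the following properties. (i) Any $u_R$-seminorm on $M$ factors uniquely through $u_M$: for every $\mathrm{Id}(R)^c$-semimodule $N$ and every $u_R$-seminorm $w: M \to N$ there is a unique monoid morphism $\hat w: \mathrm{Mod}(M,R)^c \to N$ with $\hat w\circ u_M = w$. (ii) If $f: M_1 \to M_2$ is a morphism of $R$-modules and $\mathrm{Mod}^c(f): \mathrm{Mod}(M_1,R)^c \to \mathrm{Mod}(M_2,R)^c$, $P \mapsto f(P)$, is the induced map, then $u_{M_2}\circ f = \mathrm{Mod}^c(f)\circ u_{M_1}$. (iii) The functor $\mathrm{sn}_{u_R}$ from the category of $\mathrm{Id}(R)^c$-semimodules to the category of sets that sends an $\mathrm{Id}(R)^c$-semimodule $N$ to the set $\mathrm{sn}_{u_R}(N) = \{u_R\text{-seminorms } w: M \to N\}$ is represented by $\mathrm{Mod}(M,R)^c$.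
   Context: All rings, semirings and monoids are commutative; (semi)rings have a $1$. A semiring or semimodule is idempotent if $x+x=x$ for all $x$; on such a structure the order is $a\le b$ iff $a+b=b$. $\mathrm{Id}(R)^c$ is the set of finitely generated ideals of $R$; with sum and product of ideals it is an idempotent semiring. $\mathrm{Mod}(M,R)^c$ is the set of finitely generated $R$-submodules of $M$, an idempotent monoid under sum of submodules and an $\mathrm{Id}(R)^c$-semimodule under $(J,P)\mapsto JP$. The map $u_R: R \to \mathrm{Id}(R)^c$ is $a \mapsto Ra$. Every $\mathrm{Id}(R)^c$-semimodule is automatically idempotent. For an $\mathrm{Id}(R)^c$-semimodule $N$, a $u_R$-seminorm $w: M\to N$ is a map with $w(0)=0$, $w(a+b)\le w(a)+w(b)$ for all $a,b\in M$, and such that there is a nonzero $C \in \mathrm{Id}(R)^c$ with $w(r\cdot m)\le C\,u_R(r)\cdot w(m)$ for all $r\in R$, $m\in M$. It is a $u_R$-norm if moreover $w(m)\neq 0$ for all $m\in M\setminus\{0\}$. The functor $\mathrm{sn}_{u_R}$ acts on semimodule morphisms by post-composition.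
   Formalization: R is assumed nonzero (for R = 0 there is no nonzero C, so u_M is no seminorm), and in (iii) the semimodule morphisms are additive maps h with h(0) = 0 and h(Jx) ≤ J h(x); with linear morphisms (iii) is false, e.g. for R = M = Z and N = {0,∞} with nonzero ideals acting as the identity. *)

theory Defs
  imports "HOL-Algebra.Algebra"
begin

section \<open>Semimodules over commutative semirings\<close>

text \<open>As for modules in HOL-Algebra, the multiplicative fields of the record of a semimodule are
  never used. Semimodules are unital, and both zeros act as zero.\<close>

locale semimodule = S?: semiring S + S?: comm_monoid S + N?: abelian_monoid N
  for S (structure) and N (structure) +
  assumes smult_closed [simp, intro]:
      "\<lbrakk>a \<in> carrier S; x \<in> carrier N\<rbrakk> \<Longrightarrow> a \<odot>\<^bsub>N\<^esub> x \<in> carrier N"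
    and smult_l_distr:
      "\<lbrakk>a \<in> carrier S; b \<in> carrier S; x \<in> carrier N\<rbrakk> \<Longrightarrow>
        (a \<oplus>\<^bsub>S\<^esub> b) \<odot>\<^bsub>N\<^esub> x = a \<odot>\<^bsub>N\<^esub> x \<oplus>\<^bsub>N\<^esub> b \<odot>\<^bsub>N\<^esub> x"
    and smult_r_distr:
      "\<lbrakk>a \<in> carrier S; x \<in> carrier N; y \<in> carrier N\<rbrakk> \<Longrightarrow>
        a \<odot>\<^bsub>N\<^esub> (x \<oplus>\<^bsub>N\<^esub> y) = a \<odot>\<^bsub>N\<^esub> x \<oplus>\<^bsub>N\<^esub> a \<odot>\<^bsub>N\<^esub> y"
    and smult_assoc:
      "\<lbrakk>a \<in> carrier S; b \<in> carrier S; x \<in> carrier N\<rbrakk> \<Longrightarrow>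
        (a \<otimes>\<^bsub>S\<^esub> b) \<odot>\<^bsub>N\<^esub> x = a \<odot>\<^bsub>N\<^esub> (b \<odot>\<^bsub>N\<^esub> x)"
    and smult_one [simp]: "x \<in> carrier N \<Longrightarrow> \<one>\<^bsub>S\<^esub> \<odot>\<^bsub>N\<^esub> x = x"
    and smult_l_zero [simp]: "x \<in> carrier N \<Longrightarrow> \<zero>\<^bsub>S\<^esub> \<odot>\<^bsub>N\<^esub> x = \<zero>\<^bsub>N\<^esub>"
    and smult_r_zero [simp]: "a \<in> carrier S \<Longrightarrow> a \<odot>\<^bsub>N\<^esub> \<zero>\<^bsub>N\<^esub> = \<zero>\<^bsub>N\<^esub>"

definition idem_le :: "('a, 'b) ring_scheme \<Rightarrow> 'a \<Rightarrow> 'a \<Rightarrow> bool"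
  where "idem_le N a b \<longleftrightarrow> a \<oplus>\<^bsub>N\<^esub> b = b"

text \<open>All sets of morphisms consist of functions that are extensional on the carrier of the
  source, so that equality of morphisms is equality of functions.\<close>

definition add_monoid_homs ::
    "('a, 'b) ring_scheme \<Rightarrow> ('c, 'd) ring_scheme \<Rightarrow> ('a \<Rightarrow> 'c) set"
  where "add_monoid_homs A B =
    {h \<in> extensional (carrier A). h \<in> hom (add_monoid A) (add_monoid B) \<and> h \<zero>\<^bsub>A\<^esub> = \<zero>\<^bsub>B\<^esub>}"

definition linear_homs ::
    "('s, 't) ring_scheme \<Rightarrow> ('s, 'a, 'b) module_scheme \<Rightarrow> ('s, 'c, 'd) module_scheme
      \<Rightarrow> ('a \<Rightarrow> 'c) set"
  where "linear_homs S A B =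
    {h \<in> add_monoid_homs A B.
      \<forall>s\<in>carrier S. \<forall>x\<in>carrier A. h (s \<odot>\<^bsub>A\<^esub> x) = s \<odot>\<^bsub>B\<^esub> h x}"

text \<open>The category of idempotent semimodules is taken with the subhomogeneous additive maps as
  morphisms. Every linear map is one, but seminorms are themselves only subhomogeneous, and linear
  maps alone do not represent them. For example, let every nonzero ideal of the integers act as
  the identity on \<open>N = {0, \<infinity>}\<close>. The map that sends even integers to \<open>0\<close> and odd ones to \<open>\<infinity>\<close> is a
  seminorm, but no linear map on the ideals induces it, since the ideal \<open>(2) = (2) \<cdot> (1)\<close> would
  have to be sent both to \<open>0\<close> and to \<open>(2) \<cdot> \<infinity> = \<infinity>\<close>. In fact there are only two linear maps from the
  ideals to \<open>N\<close>, but infinitely many seminorms on the integers with values in \<open>N\<close>.\<close>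

definition lax_semimodule_homs ::
    "('s, 't) ring_scheme \<Rightarrow> ('s, 'a, 'b) module_scheme \<Rightarrow> ('s, 'c, 'd) module_scheme
      \<Rightarrow> ('a \<Rightarrow> 'c) set"
  where "lax_semimodule_homs S A B =
    {h \<in> add_monoid_homs A B.
      \<forall>s\<in>carrier S. \<forall>x\<in>carrier A. idem_le B (h (s \<odot>\<^bsub>A\<^esub> x)) (s \<odot>\<^bsub>B\<^esub> h x)}"


section \<open>Finitely generated ideals and submodules\<close>

definition fg_ideals :: "('a, 'b) ring_scheme \<Rightarrow> 'a set ring"
  where "fg_ideals R =
    (ideals_set R)\<lparr>carrier := {Idl\<^bsub>R\<^esub> F | F. finite F \<and> F \<subseteq> carrier R}\<rparr>"

definition gen_submodule ::
    "('a, 'b) ring_scheme \<Rightarrow> ('a, 'm, 'c) module_scheme \<Rightarrow> 'm set \<Rightarrow> 'm set"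
  where "gen_submodule R M A = \<Inter>{H. submodule H R M \<and> A \<subseteq> H}"

definition fg_submodules ::
    "('a, 'b) ring_scheme \<Rightarrow> ('a, 'm, 'c) module_scheme \<Rightarrow> ('a set, 'm set) module"
  where "fg_submodules R M =
    \<lparr>carrier = {gen_submodule R M F | F. finite F \<and> F \<subseteq> carrier M},
     monoid.mult = undefined,
     one = undefined,
     ring.zero = {\<zero>\<^bsub>M\<^esub>},
     add = set_add M,
     smult = (\<lambda>J P. gen_submodule R M {a \<odot>\<^bsub>M\<^esub> p | a p. a \<in> J \<and> p \<in> P})\<rparr>"

definition cyclic_submodule ::
    "('a, 'b) ring_scheme \<Rightarrow> ('a, 'm, 'c) module_scheme \<Rightarrow> 'm \<Rightarrow> 'm set"
  where "cyclic_submodule R M m = {a \<odot>\<^bsub>M\<^esub> m | a. a \<in> carrier R}"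


section \<open>Seminorms and norms\<close>

definition u_seminorm ::
    "('a, 'b) ring_scheme \<Rightarrow> ('a, 'm, 'c) module_scheme \<Rightarrow> ('a set, 'n, 'd) module_scheme
      \<Rightarrow> ('m \<Rightarrow> 'n) \<Rightarrow> bool"
  where "u_seminorm R M N w \<longleftrightarrow>
    w \<in> carrier M \<rightarrow> carrier N \<and>
    w \<zero>\<^bsub>M\<^esub> = \<zero>\<^bsub>N\<^esub> \<and>
    (\<forall>a\<in>carrier M. \<forall>b\<in>carrier M. idem_le N (w (a \<oplus>\<^bsub>M\<^esub> b)) (w a \<oplus>\<^bsub>N\<^esub> w b)) \<and>
    (\<exists>C\<in>carrier (fg_ideals R). C \<noteq> \<zero>\<^bsub>fg_ideals R\<^esub> \<and>
      (\<forall>r\<in>carrier R. \<forall>m\<in>carrier M.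
        idem_le N (w (r \<odot>\<^bsub>M\<^esub> m)) ((C \<otimes>\<^bsub>fg_ideals R\<^esub> PIdl\<^bsub>R\<^esub> r) \<odot>\<^bsub>N\<^esub> w m)))"

definition u_norm ::
    "('a, 'b) ring_scheme \<Rightarrow> ('a, 'm, 'c) module_scheme \<Rightarrow> ('a set, 'n, 'd) module_scheme
      \<Rightarrow> ('m \<Rightarrow> 'n) \<Rightarrow> bool"
  where "u_norm R M N w \<longleftrightarrow>
    u_seminorm R M N w \<and> (\<forall>m\<in>carrier M - {\<zero>\<^bsub>M\<^esub>}. w m \<noteq> \<zero>\<^bsub>N\<^esub>)"

definition sn ::
    "('a, 'b) ring_scheme \<Rightarrow> ('a, 'm, 'c) module_scheme \<Rightarrow> ('a set, 'n, 'd) module_scheme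
      \<Rightarrow> ('m \<Rightarrow> 'n) set"
  where "sn R M N = {w \<in> extensional (carrier M). u_seminorm R M N w}"

text \<open>The action of the functor \<^const>\<open>sn\<close> on a morphism \<open>\<psi>\<close>.\<close>

definition sn_map :: "('a, 'm, 'c) module_scheme \<Rightarrow> ('n \<Rightarrow> 'p) \<Rightarrow> ('m \<Rightarrow> 'n) \<Rightarrow> ('m \<Rightarrow> 'p)"
  where "sn_map M \<psi> w = compose (carrier M) \<psi> w"

end

theory Submission
  imports Defs
begin

text \<open>A \<open>u_R\<close>-seminorm \<open>w\<close> satisfies \<open>w (r m) \<le> (R r) (w m) \<le> w m\<close>, because every ideal lies
  below the unit ideal. Hence \<open>{m. w m \<le> n}\<close> is a submodule for every \<open>n\<close>, so that the finite
  supremum of \<open>w\<close> over a generating set depends only on the generated submodule. This supremum is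
  the factorization of \<open>w\<close> through \<open>m \<mapsto> R m\<close>, and it is forced because a finitely generated
  submodule is the sum of the cyclic submodules of its generators.\<close>

section \<open>Generated ideals and submodules\<close>

text \<open>So the proof works throughout with w (r m) \<le> (R r) (w m). Conversely, this
  inequality gives a seminorm with C = R, which is nonzero exactly when 1 \<noteq> 0. Over the zero
  ring no nonzero ideal exists, so no map is a seminorm, not even
  \<open>cyclic_submodule R M\<close>; this is the reason for the hypothesis on \<open>R\<close>.
  The factorization is in general only subhomogeneous: on a product a p, \<open>w\<close> may be
  strictly smaller than (R a) (w p), and taking suprema keeps the inequality but does not turn it
  into an equation. The algebra of ideals and submodules is done on generators. Sums become unions
  and products become sets of products of generators, so finite generation is preserved and the
  semimodule laws turn into elementary facts about sets.\<close>

lemma set_addI: "\<lbrakk>x \<in> A; y \<in> B\<rbrakk> \<Longrightarrow> x \<oplus>\<^bsub>G\<^esub> y \<in> A <+>\<^bsub>G\<^esub> B"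
  unfolding set_add_def' by blast

lemma set_addE:
  assumes "z \<in> A <+>\<^bsub>G\<^esub> B"
  obtains x y where "x \<in> A" "y \<in> B" "z = x \<oplus>\<^bsub>G\<^esub> y"
  using assms unfolding set_add_def' by blast

text \<open>Replacing \<open>A\<close> and \<open>B\<close> by the ideals that they generate does
  not change the ideal generated by the union, and \<open>union_genideal\<close> then identifies it
  with the sum. Sums of finitely generated ideals are therefore finitely generated.\<close>

lemma (in cring) genideal_Un:
  assumes "A \<subseteq> carrier R" "B \<subseteq> carrier R"
  shows "Idl (A \<union> B) = Idl A <+> Idl B"
proof -
  have ideals: "ideal (Idl A) R" "ideal (Idl B) R" "ideal (Idl (A \<union> B)) R"
    using assms by (auto intro: genideal_ideal)
  have "Idl (A \<union> B) = Idl (Idl A \<union> Idl B)"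
  proof
    have "A \<union> B \<subseteq> Idl (Idl A \<union> Idl B)"
      using assms ideals[THEN ideal.Icarr] unfolding genideal_def by blast
    moreover have "ideal (Idl (Idl A \<union> Idl B)) R"
      using ideals[THEN ideal.Icarr] by (intro genideal_ideal) auto
    ultimately show "Idl (A \<union> B) \<subseteq> Idl (Idl A \<union> Idl B)"
      by (rule genideal_minimal[rotated])
    have "Idl A \<subseteq> Idl (A \<union> B)" "Idl B \<subseteq> Idl (A \<union> B)"
      unfolding genideal_def by blast+
    then show "Idl (Idl A \<union> Idl B) \<subseteq> Idl (A \<union> B)"
      using ideals(3) by (intro genideal_minimal) auto
  qed
  then show ?thesis
    using ideals by (simp add: union_genideal)
qed

text \<open>This is the colon ideal (I : b). It carries a membership statement from generators to
  the ideal they generate: if it contains a set \<open>A\<close>, it contains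
  \<open>Idl A\<close>.\<close>

lemma (in cring) ideal_vimage_mult:
  assumes "ideal I R" "b \<in> carrier R"
  shows "ideal {a \<in> carrier R. a \<otimes> b \<in> I} R"
proof -
  interpret I: ideal I R by fact
  show ?thesis
  proof (rule idealI[OF ring_axioms])
    show "subgroup {a \<in> carrier R. a \<otimes> b \<in> I} (add_monoid R)"
      using assms(2)
      by unfold_locales
        (auto simp: l_distr l_minus I.a_closed I.a_inv_closed simp flip: a_inv_def)
    show "x \<otimes> a \<in> {a \<in> carrier R. a \<otimes> b \<in> I}"
      if "a \<in> {a \<in> carrier R. a \<otimes> b \<in> I}" "x \<in> carrier R" for a x
      using that assms(2) by (auto simp: m_assoc I.I_l_closed)
    then show "a \<otimes> x \<in> {a \<in> carrier R. a \<otimes> b \<in> I}"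
      if "a \<in> {a \<in> carrier R. a \<otimes> b \<in> I}" "x \<in> carrier R" for a x
      using that m_comm by fastforce
  qed
qed

text \<open>The inclusion from left to right extends one factor at a time: for a fixed generator in
  \<open>B\<close> a colon ideal leads from \<open>A\<close> to \<open>Idl A\<close>, and for a
  fixed element of \<open>Idl A\<close> another one leads from \<open>B\<close> to
  \<open>Idl B\<close>.\<close>

lemma (in cring) genideal_set_mult:
  assumes "A \<subseteq> carrier R" "B \<subseteq> carrier R"
  shows "ideal_prod R (Idl A) (Idl B) = Idl (A <#> B)"
proof
  have carr: "A <#> B \<subseteq> carrier R"
    using assms by (rule set_mult_closed)
  note ideal_AB = genideal_ideal[OF carr]
  have *: "a \<otimes> b \<in> Idl (A <#> B)" if "a \<in> Idl A" "b \<in> B" for a b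
  proof -
    have "A \<subseteq> {a \<in> carrier R. a \<otimes> b \<in> Idl (A <#> B)}"
      using assms that(2) genideal_self[OF carr] unfolding set_mult_def by blast
    moreover have "b \<in> carrier R" using assms that by auto
    ultimately show ?thesis
      using genideal_minimal[OF ideal_vimage_mult[OF ideal_AB]] that(1) by blast
  qed
  have **: "a \<otimes> b \<in> Idl (A <#> B)" if "a \<in> Idl A" "b \<in> Idl B" for a b
  proof -
    have a: "a \<in> carrier R"
      using that(1) assms(1) genideal_ideal ideal.Icarr by metis
    \<comment> \<open>\<open>ideal_vimage_mult\<close> has its fixed factor on the right, so the
      product is written as b a here and turned round by commutativity afterwards.\<close>
    then have "B \<subseteq> {b \<in> carrier R. b \<otimes> a \<in> Idl (A <#> B)}"
      using assms * that(1) m_comm by fastforce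
    then have "b \<in> {b \<in> carrier R. b \<otimes> a \<in> Idl (A <#> B)}"
      using genideal_minimal[OF ideal_vimage_mult[OF ideal_AB a]] that(2) by blast
    then show ?thesis
      using a by (metis (no_types, lifting) CollectD m_comm)
  qed
  have ideals: "ideal (Idl A) R" "ideal (Idl B) R"
    using assms by (auto intro: genideal_ideal)
  show "ideal_prod R (Idl A) (Idl B) \<subseteq> Idl (A <#> B)"
    unfolding ideal_prod_eq_genideal[OF ideals]
    using ** by (intro genideal_minimal ideal_AB) (auto simp: set_mult_def)
  show "Idl (A <#> B) \<subseteq> ideal_prod R (Idl A) (Idl B)"
    using genideal_self[OF assms(1)] genideal_self[OF assms(2)]
    by (intro genideal_minimal ideal_prod_is_ideal ideals)
      (auto simp: set_mult_def intro!: ideal_prod.prod)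
qed

section \<open>Generated and cyclic submodules\<close>

lemma (in module) submoduleI':
  assumes "H \<subseteq> carrier M" "\<zero>\<^bsub>M\<^esub> \<in> H"
    and "\<And>x y. \<lbrakk>x \<in> H; y \<in> H\<rbrakk> \<Longrightarrow> x \<oplus>\<^bsub>M\<^esub> y \<in> H"
    and "\<And>a x. \<lbrakk>a \<in> carrier R; x \<in> H\<rbrakk> \<Longrightarrow> a \<odot>\<^bsub>M\<^esub> x \<in> H"
  shows "submodule H R M"
proof (rule submoduleI)
  show "\<ominus>\<^bsub>M\<^esub> x \<in> H" if "x \<in> H" for x
  proof -
    have "\<ominus>\<^bsub>M\<^esub> x = (\<ominus> \<one>) \<odot>\<^bsub>M\<^esub> x"
      using that assms(1) by (subst smult_l_minus) auto
    then show ?thesis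
      using assms(4)[OF _ that, of "\<ominus> \<one>"] by simp
  qed
qed (use assms in auto)

lemma (in module) submodule_zero_mem: "submodule H R M \<Longrightarrow> \<zero>\<^bsub>M\<^esub> \<in> H"
  using subgroup.one_closed[of H "add_monoid M"] by (simp add: submodule_def)

context module
begin

abbreviation gen :: "'c set \<Rightarrow> 'c set"
  where "gen \<equiv> gen_submodule R M"

lemma gen_minimal: "\<lbrakk>submodule H R M; A \<subseteq> H\<rbrakk> \<Longrightarrow> gen A \<subseteq> H"
  unfolding gen_submodule_def by blast

lemma gen_superset: "A \<subseteq> gen A"
  unfolding gen_submodule_def by blast

lemma gen_mono: "A \<subseteq> B \<Longrightarrow> gen A \<subseteq> gen B"
  unfolding gen_submodule_def by blast

lemma gen_in_carrier: "A \<subseteq> carrier M \<Longrightarrow> gen A \<subseteq> carrier M"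
  using gen_minimal[OF carrier_is_submodule] .

lemma submodule_gen:
  assumes "A \<subseteq> carrier M"
  shows "submodule (gen A) R M"
proof (rule submoduleI')
  show "gen A \<subseteq> carrier M" using gen_in_carrier[OF assms] .
qed (auto simp: gen_submodule_def intro: submodule_zero_mem submoduleE(4,5))

lemma submodule_set_add:
  assumes "submodule H R M" "submodule K R M"
  shows "submodule (H <+>\<^bsub>M\<^esub> K) R M"
proof (rule submoduleI')
  note H = submoduleE[OF assms(1)] and K = submoduleE[OF assms(2)]
  show "H <+>\<^bsub>M\<^esub> K \<subseteq> carrier M"
    using H(1) K(1) by (rule M.set_add_closed)
  show "\<zero>\<^bsub>M\<^esub> \<in> H <+>\<^bsub>M\<^esub> K"
    using set_addI[OF submodule_zero_mem[OF assms(1)] submodule_zero_mem[OF assms(2)], of M] by simp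
  show "x \<oplus>\<^bsub>M\<^esub> y \<in> H <+>\<^bsub>M\<^esub> K" if xy: "x \<in> H <+>\<^bsub>M\<^esub> K" "y \<in> H <+>\<^bsub>M\<^esub> K" for x y
  proof -
    obtain h k where hk: "h \<in> H" "k \<in> K" "x = h \<oplus>\<^bsub>M\<^esub> k"
      using xy(1) by (rule set_addE)
    obtain h' k' where hk': "h' \<in> H" "k' \<in> K" "y = h' \<oplus>\<^bsub>M\<^esub> k'"
      using xy(2) by (rule set_addE)
    have "h \<in> carrier M" "k \<in> carrier M" "h' \<in> carrier M" "k' \<in> carrier M"
      using hk hk' H(1) K(1) by auto
    then have "x \<oplus>\<^bsub>M\<^esub> y = (h \<oplus>\<^bsub>M\<^esub> h') \<oplus>\<^bsub>M\<^esub> (k \<oplus>\<^bsub>M\<^esub> k')"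
      using hk hk' by (simp add: M.a_ac)
    then show ?thesis
      using hk hk' by (simp add: set_addI H(5) K(5))
  qed
  show "a \<odot>\<^bsub>M\<^esub> x \<in> H <+>\<^bsub>M\<^esub> K" if a: "a \<in> carrier R" and x: "x \<in> H <+>\<^bsub>M\<^esub> K" for a x
  proof -
    obtain h k where hk: "h \<in> H" "k \<in> K" "x = h \<oplus>\<^bsub>M\<^esub> k"
      using x by (rule set_addE)
    then have "h \<in> carrier M" "k \<in> carrier M"
      using H(1) K(1) by auto
    then show ?thesis
      using hk a by (simp add: smult_r_distr set_addI H(4) K(4))
  qed
qed

text \<open>With this, the monoid laws of \<open>fg_submodules\<close> become the laws of union, and
  a finitely generated submodule can be split into cyclic ones, generator by generator.\<close>

lemma gen_Un:
  assumes "A \<subseteq> carrier M" "B \<subseteq> carrier M"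
  shows "gen (A \<union> B) = gen A <+>\<^bsub>M\<^esub> gen B"
proof
  note sub = submodule_gen[OF assms(1)] submodule_gen[OF assms(2)]
  have "x \<in> gen A <+>\<^bsub>M\<^esub> gen B" if "x \<in> A" for x
  proof -
    have "x \<in> gen A" "x \<in> carrier M"
      using that assms gen_superset[of A] by blast+
    then show ?thesis
      using set_addI[OF _ submodule_zero_mem[OF sub(2)], of x "gen A" M] by simp
  qed
  moreover have "x \<in> gen A <+>\<^bsub>M\<^esub> gen B" if "x \<in> B" for x
  proof -
    have "x \<in> gen B" "x \<in> carrier M"
      using that assms gen_superset[of B] by blast+
    then show ?thesis
      using set_addI[OF submodule_zero_mem[OF sub(1)], of x "gen B" M] by simp
  qed
  ultimately show "gen (A \<union> B) \<subseteq> gen A <+>\<^bsub>M\<^esub> gen B"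
    by (intro gen_minimal submodule_set_add sub) blast
  have "gen A \<subseteq> gen (A \<union> B)" "gen B \<subseteq> gen (A \<union> B)"
    by (simp_all add: gen_mono)
  moreover have "submodule (gen (A \<union> B)) R M"
    using assms by (simp add: submodule_gen)
  ultimately show "gen A <+>\<^bsub>M\<^esub> gen B \<subseteq> gen (A \<union> B)"
    by (blast elim: set_addE intro: submoduleE(5))
qed

lemma submodule_zero: "submodule {\<zero>\<^bsub>M\<^esub>} R M"
  by (rule submoduleI') auto

lemma gen_empty: "gen {} = {\<zero>\<^bsub>M\<^esub>}"
proof
  show "gen {} \<subseteq> {\<zero>\<^bsub>M\<^esub>}"
    by (simp add: gen_minimal submodule_zero)
  show "{\<zero>\<^bsub>M\<^esub>} \<subseteq> gen {}"
    using submodule_zero_mem[OF submodule_gen[of "{}"]] by simp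
qed

lemma cyclic_submoduleI: "a \<in> carrier R \<Longrightarrow> a \<odot>\<^bsub>M\<^esub> m \<in> cyclic_submodule R M m"
  unfolding cyclic_submodule_def by blast

lemma cyclic_submoduleE:
  assumes "x \<in> cyclic_submodule R M m"
  obtains a where "a \<in> carrier R" "x = a \<odot>\<^bsub>M\<^esub> m"
  using assms unfolding cyclic_submodule_def by blast

lemma submodule_cyclic:
  assumes "m \<in> carrier M"
  shows "submodule (cyclic_submodule R M m) R M"
proof (rule submoduleI')
  show "\<zero>\<^bsub>M\<^esub> \<in> cyclic_submodule R M m"
    using cyclic_submoduleI[OF R.zero_closed, of m] assms by simp
  show "x \<oplus>\<^bsub>M\<^esub> y \<in> cyclic_submodule R M m"
    if "x \<in> cyclic_submodule R M m" "y \<in> cyclic_submodule R M m" for x y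
    using that assms
    by (elim cyclic_submoduleE) (simp add: cyclic_submoduleI flip: smult_l_distr)
  show "a \<odot>\<^bsub>M\<^esub> x \<in> cyclic_submodule R M m"
    if "a \<in> carrier R" "x \<in> cyclic_submodule R M m" for a x
    using that assms
    by (elim cyclic_submoduleE) (simp add: cyclic_submoduleI flip: smult_assoc1)
qed (use assms in \<open>auto simp: cyclic_submodule_def\<close>)

lemma mem_cyclic_submodule: "m \<in> carrier M \<Longrightarrow> m \<in> cyclic_submodule R M m"
  using cyclic_submoduleI[OF R.one_closed, of m] by simp

lemma gen_singleton:
  assumes "m \<in> carrier M"
  shows "gen {m} = cyclic_submodule R M m"
proof
  show "gen {m} \<subseteq> cyclic_submodule R M m"
    using assms by (simp add: gen_minimal submodule_cyclic mem_cyclic_submodule)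
  have "m \<in> gen {m}" "submodule (gen {m}) R M"
    using assms gen_superset[of "{m}"] by (simp_all add: submodule_gen)
  then show "cyclic_submodule R M m \<subseteq> gen {m}"
    by (auto elim!: cyclic_submoduleE intro: submoduleE(4))
qed

lemma cyclic_submodule_zero: "cyclic_submodule R M \<zero>\<^bsub>M\<^esub> = {\<zero>\<^bsub>M\<^esub>}"
  using mem_cyclic_submodule[OF M.zero_closed] by (auto elim: cyclic_submoduleE)

text \<open>The bare set of products, without passing to the generated submodule. It stays finite
  for finite arguments and so serves as the generating set of a product.\<close>

definition smult_set :: "'a set \<Rightarrow> 'c set \<Rightarrow> 'c set"
  where "smult_set A B = {a \<odot>\<^bsub>M\<^esub> x | a x. a \<in> A \<and> x \<in> B}"

lemma finite_smult_set: "\<lbrakk>finite A; finite B\<rbrakk> \<Longrightarrow> finite (smult_set A B)"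
  unfolding smult_set_def by (rule finite_image_set2) simp_all

lemma smult_set_in_carrier: "\<lbrakk>A \<subseteq> carrier R; B \<subseteq> carrier M\<rbrakk> \<Longrightarrow> smult_set A B \<subseteq> carrier M"
  unfolding smult_set_def by blast

lemma smult_set_set_mult:
  assumes "A \<subseteq> carrier R" "B \<subseteq> carrier R" "C \<subseteq> carrier M"
  shows "smult_set (A <#>\<^bsub>R\<^esub> B) C = smult_set A (smult_set B C)"
proof -
  have "(a \<otimes> b) \<odot>\<^bsub>M\<^esub> x = a \<odot>\<^bsub>M\<^esub> (b \<odot>\<^bsub>M\<^esub> x)" if "a \<in> A" "b \<in> B" "x \<in> C" for a b x
    using that assms by (intro smult_assoc1) auto
  then show ?thesis
    unfolding smult_set_def set_mult_def by (auto, metis+)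
qed

text \<open>The colon ideal (H : x). Together with the submodule in
  \<open>submodule_vimage_smult\<close> it allows the scalars and the vectors of a product to be
  extended separately from generators.\<close>

lemma ideal_vimage_smult:
  assumes "submodule H R M" "x \<in> carrier M"
  shows "ideal {a \<in> carrier R. a \<odot>\<^bsub>M\<^esub> x \<in> H} R"
proof (rule idealI)
  note H = submoduleE[OF assms(1)] submodule_zero_mem[OF assms(1)]
  show "ring R" by (rule R.ring_axioms)
  show "subgroup {a \<in> carrier R. a \<odot>\<^bsub>M\<^esub> x \<in> H} (add_monoid R)"
    using assms(2) H
    by unfold_locales (auto simp: smult_l_distr smult_l_minus simp flip: a_inv_def)
  show "b \<otimes> a \<in> {a \<in> carrier R. a \<odot>\<^bsub>M\<^esub> x \<in> H}"
    if "a \<in> {a \<in> carrier R. a \<odot>\<^bsub>M\<^esub> x \<in> H}" "b \<in> carrier R" for a b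
    using that assms(2) H by (auto simp: smult_assoc1)
  then show "a \<otimes> b \<in> {a \<in> carrier R. a \<odot>\<^bsub>M\<^esub> x \<in> H}"
    if "a \<in> {a \<in> carrier R. a \<odot>\<^bsub>M\<^esub> x \<in> H}" "b \<in> carrier R" for a b
    using that R.m_comm by fastforce
qed

lemma submodule_vimage_smult:
  assumes "submodule H R M" "a \<in> carrier R"
  shows "submodule {x \<in> carrier M. a \<odot>\<^bsub>M\<^esub> x \<in> H} R M"
proof (rule submoduleI')
  note H = submoduleE[OF assms(1)] submodule_zero_mem[OF assms(1)]
  show "b \<odot>\<^bsub>M\<^esub> x \<in> {x \<in> carrier M. a \<odot>\<^bsub>M\<^esub> x \<in> H}"
    if "b \<in> carrier R" "x \<in> {x \<in> carrier M. a \<odot>\<^bsub>M\<^esub> x \<in> H}" for b x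
  proof -
    \<comment> \<open>Commutativity of \<open>R\<close> makes multiplication by \<open>a\<close>
      linear.\<close>
    have "a \<odot>\<^bsub>M\<^esub> (b \<odot>\<^bsub>M\<^esub> x) = b \<odot>\<^bsub>M\<^esub> (a \<odot>\<^bsub>M\<^esub> x)"
      using that assms(2) R.m_comm[of a b] by (auto simp flip: smult_assoc1)
    then show ?thesis using that H(4) by auto
  qed
qed (use assms(2) submoduleE[OF assms(1)] submodule_zero_mem[OF assms(1)] in
      \<open>auto simp: smult_r_distr\<close>)

text \<open>The module analogue of \<open>genideal_set_mult\<close>: the scalars are extended from
  \<open>A\<close> to \<open>Idl A\<close> for a fixed vector in \<open>B\<close>, then the vectors
  from \<open>B\<close> to \<open>gen B\<close> for a fixed scalar. Every computation with the
  action of ideals goes through this lemma.\<close>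

lemma gen_smult_set:
  assumes "A \<subseteq> carrier R" "B \<subseteq> carrier M"
  shows "gen (smult_set (Idl A) (gen B)) = gen (smult_set A B)"
proof
  note sub = submodule_gen[OF smult_set_in_carrier[OF assms]]
  have *: "a \<odot>\<^bsub>M\<^esub> x \<in> gen (smult_set A B)" if "a \<in> Idl A" "x \<in> B" for a x
  proof -
    have "A \<subseteq> {a \<in> carrier R. a \<odot>\<^bsub>M\<^esub> x \<in> gen (smult_set A B)}"
      using assms that(2) gen_superset[of "smult_set A B"] unfolding smult_set_def by blast
    moreover have "x \<in> carrier M" using that assms by auto
    ultimately show ?thesis
      using R.genideal_minimal[OF ideal_vimage_smult[OF sub]] that(1) by blast
  qed
  have "a \<odot>\<^bsub>M\<^esub> x \<in> gen (smult_set A B)" if "a \<in> Idl A" "x \<in> gen B" for a x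
  proof -
    have "B \<subseteq> {x \<in> carrier M. a \<odot>\<^bsub>M\<^esub> x \<in> gen (smult_set A B)}"
      using assms * that(1) by auto
    moreover have "a \<in> carrier R"
      using that assms R.genideal_ideal ideal.Icarr by metis
    ultimately show ?thesis
      using gen_minimal[OF submodule_vimage_smult[OF sub]] that(2) by blast
  qed
  then show "gen (smult_set (Idl A) (gen B)) \<subseteq> gen (smult_set A B)"
    by (intro gen_minimal sub) (auto simp: smult_set_def)
  show "gen (smult_set A B) \<subseteq> gen (smult_set (Idl A) (gen B))"
    using R.genideal_self[OF assms(1)] gen_superset[of B]
    by (intro gen_mono) (auto simp: smult_set_def)
qed

end

section \<open>The semimodule of finitely generated submodules\<close>

lemma fg_ideals_simps [simp]:
  "monoid.mult (fg_ideals R) = ideal_prod R"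
  "monoid.one (fg_ideals R) = carrier R"
  "ring.zero (fg_ideals R) = {\<zero>\<^bsub>R\<^esub>}"
  "ring.add (fg_ideals R) = set_add R"
  by (simp_all add: fg_ideals_def ideals_set_def)

lemma carrier_fg_ideals:
  "carrier (fg_ideals R) = {Idl\<^bsub>R\<^esub> F | F. finite F \<and> F \<subseteq> carrier R}"
  by (simp add: fg_ideals_def)

lemma fg_idealsI: "\<lbrakk>finite F; F \<subseteq> carrier R\<rbrakk> \<Longrightarrow> Idl\<^bsub>R\<^esub> F \<in> carrier (fg_ideals R)"
  by (auto simp: carrier_fg_ideals)

lemma fg_idealsE:
  assumes "I \<in> carrier (fg_ideals R)"
  obtains F where "finite F" "F \<subseteq> carrier R" "I = Idl\<^bsub>R\<^esub> F"
  using assms by (auto simp: carrier_fg_ideals)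

context cring
begin

lemma fg_ideals_ideal: "I \<in> carrier (fg_ideals R) \<Longrightarrow> ideal I R"
  by (auto simp: carrier_fg_ideals genideal_ideal)

lemma zero_fg_ideals: "{\<zero>} \<in> carrier (fg_ideals R)"
  using fg_idealsI[of "{\<zero>}" R] by (simp add: genideal_zero)

lemma one_fg_ideals: "carrier R \<in> carrier (fg_ideals R)"
  using fg_idealsI[of "{\<one>}" R] by (simp add: genideal_one)

lemma PIdl_fg_ideals: "a \<in> carrier R \<Longrightarrow> PIdl a \<in> carrier (fg_ideals R)"
  by (simp add: cgenideal_eq_genideal fg_idealsI)

lemma set_add_fg_ideals:
  "\<lbrakk>I \<in> carrier (fg_ideals R); J \<in> carrier (fg_ideals R)\<rbrakk> \<Longrightarrow> I <+> J \<in> carrier (fg_ideals R)"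
  by (elim fg_idealsE) (simp add: fg_idealsI flip: genideal_Un)

lemma ideal_prod_fg_ideals:
  assumes "I \<in> carrier (fg_ideals R)" "J \<in> carrier (fg_ideals R)"
  shows "ideal_prod R I J \<in> carrier (fg_ideals R)"
proof -
  obtain F where F: "finite F" "F \<subseteq> carrier R" "I = Idl F" using assms(1) by (rule fg_idealsE)
  obtain G where G: "finite G" "G \<subseteq> carrier R" "J = Idl G" using assms(2) by (rule fg_idealsE)
  have "finite (F <#> G)" using F G by (simp add: set_mult_def)
  then show ?thesis
    using F G by (simp add: genideal_set_mult set_mult_closed fg_idealsI)
qed

lemma idem_le_fg_ideals:
  assumes "ideal I R" "ideal J R" "I \<subseteq> J"
  shows "idem_le (fg_ideals R) I J"
proof -
  have "J = Idl J"
    using assms(2) by (metis additive_subgroup.a_subset genideal_minimal genideal_self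
        ideal.axioms(1) subset_antisym subset_refl)
  then show ?thesis
    using assms union_genideal[OF assms(1,2)] by (simp add: idem_le_def Un_absorb1)
qed

text \<open>The operations are those of \<open>ideals_set R\<close> on a smaller carrier, so the
  laws are inherited and only closure needs the work on generators.\<close>

lemma semiring_fg_ideals: "semiring (fg_ideals R)"
proof -
  interpret I: semiring "ideals_set R" by (rule ideals_set_is_semiring)
  have sub: "carrier (fg_ideals R) \<subseteq> carrier (ideals_set R)"
    by (auto simp: ideals_set_def fg_ideals_ideal)
  have eqs: "ring.add (fg_ideals R) = ring.add (ideals_set R)"
    "ring.zero (fg_ideals R) = ring.zero (ideals_set R)"
    "monoid.mult (fg_ideals R) = monoid.mult (ideals_set R)"
    "monoid.one (fg_ideals R) = monoid.one (ideals_set R)"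
    by (simp_all add: fg_ideals_def)
  have cl: "\<zero>\<^bsub>ideals_set R\<^esub> \<in> carrier (fg_ideals R)" "\<one>\<^bsub>ideals_set R\<^esub> \<in> carrier (fg_ideals R)"
    "\<And>I J. \<lbrakk>I \<in> carrier (fg_ideals R); J \<in> carrier (fg_ideals R)\<rbrakk> \<Longrightarrow>
      I \<oplus>\<^bsub>ideals_set R\<^esub> J \<in> carrier (fg_ideals R)"
    "\<And>I J. \<lbrakk>I \<in> carrier (fg_ideals R); J \<in> carrier (fg_ideals R)\<rbrakk> \<Longrightarrow>
      I \<otimes>\<^bsub>ideals_set R\<^esub> J \<in> carrier (fg_ideals R)"
    using zero_fg_ideals one_fg_ideals set_add_fg_ideals ideal_prod_fg_ideals
    by (simp_all flip: eqs)
  show ?thesis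
  proof (intro semiring.intro abelian_monoidI monoidI semiring_axioms.intro; unfold eqs)
  qed (use sub in \<open>simp_all add: cl subset_iff I.a_ac I.m_assoc I.l_distr I.r_distr\<close>)
qed

lemma comm_monoid_fg_ideals: "comm_monoid (fg_ideals R)"
proof -
  interpret semiring "fg_ideals R" by (rule semiring_fg_ideals)
  show ?thesis
    by (intro comm_monoid.intro comm_monoid_axioms.intro monoid_axioms)
      (simp add: ideal_prod_commute fg_ideals_ideal)
qed

end

section \<open>The action of finitely generated ideals on finitely generated submodules\<close>

lemma fg_submodules_simps [simp]:
  "ring.zero (fg_submodules R M) = {\<zero>\<^bsub>M\<^esub>}"
  "ring.add (fg_submodules R M) = set_add M"
  by (simp_all add: fg_submodules_def)

context module
begin

lemma carrier_fg_submodules: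
  "carrier (fg_submodules R M) = {gen F | F. finite F \<and> F \<subseteq> carrier M}"
  by (simp add: fg_submodules_def)

lemma fg_submodulesI: "\<lbrakk>finite F; F \<subseteq> carrier M\<rbrakk> \<Longrightarrow> gen F \<in> carrier (fg_submodules R M)"
  by (auto simp: carrier_fg_submodules)

lemma fg_submodulesE:
  assumes "P \<in> carrier (fg_submodules R M)"
  obtains F where "finite F" "F \<subseteq> carrier M" "P = gen F"
  using assms by (auto simp: carrier_fg_submodules)

lemma smult_fg_submodules: "module.smult (fg_submodules R M) I P = gen (smult_set I P)"
  by (simp add: fg_submodules_def smult_set_def)

lemma cyclic_fg_submodules:
  "m \<in> carrier M \<Longrightarrow> cyclic_submodule R M m \<in> carrier (fg_submodules R M)"
  using fg_submodulesI[of "{m}"] by (simp add: gen_singleton)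

lemma abelian_monoid_fg_submodules: "abelian_monoid (fg_submodules R M)"
proof (rule abelian_monoidI; simp)
  show "P <+>\<^bsub>M\<^esub> Q \<in> carrier (fg_submodules R M)"
    if "P \<in> carrier (fg_submodules R M)" "Q \<in> carrier (fg_submodules R M)" for P Q
    using that by (elim fg_submodulesE) (simp add: fg_submodulesI flip: gen_Un)
  show "{\<zero>\<^bsub>M\<^esub>} \<in> carrier (fg_submodules R M)"
    using fg_submodulesI[of "{}"] by (simp add: gen_empty)
  show "P <+>\<^bsub>M\<^esub> Q <+>\<^bsub>M\<^esub> L = P <+>\<^bsub>M\<^esub> (Q <+>\<^bsub>M\<^esub> L)"
    if "P \<in> carrier (fg_submodules R M)" "Q \<in> carrier (fg_submodules R M)"
      "L \<in> carrier (fg_submodules R M)" for P Q L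
    using that by (elim fg_submodulesE) (simp add: Un_assoc flip: gen_Un)
  show "{\<zero>\<^bsub>M\<^esub>} <+>\<^bsub>M\<^esub> P = P" if "P \<in> carrier (fg_submodules R M)" for P
    using that by (elim fg_submodulesE) (simp flip: gen_empty gen_Un)
  show "P <+>\<^bsub>M\<^esub> Q = Q <+>\<^bsub>M\<^esub> P"
    if "P \<in> carrier (fg_submodules R M)" "Q \<in> carrier (fg_submodules R M)" for P Q
    using that by (elim fg_submodulesE) (simp add: Un_commute flip: gen_Un)
qed

lemma fg_submodules_smult_Idl:
  "\<lbrakk>A \<subseteq> carrier R; B \<subseteq> carrier M\<rbrakk> \<Longrightarrow>
    Idl A \<odot>\<^bsub>fg_submodules R M\<^esub> gen B = gen (smult_set A B)"
  by (simp add: smult_fg_submodules gen_smult_set)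

text \<open>Each law is checked on generators: both distributive laws hold because
  \<open>smult_set\<close> distributes over unions in each argument, associativity is
  \<open>smult_set_set_mult\<close>, and the unit and zero ideals are generated by
  \<open>{\<one>}\<close> and \<open>{\<zero>}\<close>.\<close>

lemma semimodule_fg_submodules: "semimodule (fg_ideals R) (fg_submodules R M)"
proof (intro semimodule.intro semimodule_axioms.intro R.semiring_fg_ideals
    R.comm_monoid_fg_ideals abelian_monoid_fg_submodules)
  fix I P
  assume "I \<in> carrier (fg_ideals R)" "P \<in> carrier (fg_submodules R M)"
  then show "I \<odot>\<^bsub>fg_submodules R M\<^esub> P \<in> carrier (fg_submodules R M)"
    by (elim fg_idealsE fg_submodulesE)
      (simp add: fg_submodules_smult_Idl fg_submodulesI finite_smult_set smult_set_in_carrier)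
next
  fix I J P
  assume "I \<in> carrier (fg_ideals R)" "J \<in> carrier (fg_ideals R)"
    "P \<in> carrier (fg_submodules R M)"
  moreover have "smult_set (A \<union> B) C = smult_set A C \<union> smult_set B C" for A B C
    by (auto simp: smult_set_def)
  ultimately show "(I \<oplus>\<^bsub>fg_ideals R\<^esub> J) \<odot>\<^bsub>fg_submodules R M\<^esub> P =
      I \<odot>\<^bsub>fg_submodules R M\<^esub> P \<oplus>\<^bsub>fg_submodules R M\<^esub> J \<odot>\<^bsub>fg_submodules R M\<^esub> P"
    by (elim fg_idealsE fg_submodulesE)
      (simp add: fg_submodules_smult_Idl gen_Un smult_set_in_carrier flip: R.genideal_Un)
next
  fix I P Q
  assume "I \<in> carrier (fg_ideals R)" "P \<in> carrier (fg_submodules R M)"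
    "Q \<in> carrier (fg_submodules R M)"
  moreover have "smult_set A (B \<union> C) = smult_set A B \<union> smult_set A C" for A B C
    by (auto simp: smult_set_def)
  ultimately show "I \<odot>\<^bsub>fg_submodules R M\<^esub> (P \<oplus>\<^bsub>fg_submodules R M\<^esub> Q) =
      I \<odot>\<^bsub>fg_submodules R M\<^esub> P \<oplus>\<^bsub>fg_submodules R M\<^esub> I \<odot>\<^bsub>fg_submodules R M\<^esub> Q"
    by (elim fg_idealsE fg_submodulesE)
      (simp add: fg_submodules_smult_Idl smult_set_in_carrier flip: gen_Un)
next
  fix I J P
  assume "I \<in> carrier (fg_ideals R)" "J \<in> carrier (fg_ideals R)"
    "P \<in> carrier (fg_submodules R M)"
  then show "(I \<otimes>\<^bsub>fg_ideals R\<^esub> J) \<odot>\<^bsub>fg_submodules R M\<^esub> P =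
      I \<odot>\<^bsub>fg_submodules R M\<^esub> (J \<odot>\<^bsub>fg_submodules R M\<^esub> P)"
    by (elim fg_idealsE fg_submodulesE)
      (simp add: fg_submodules_smult_Idl R.genideal_set_mult R.set_mult_closed
        smult_set_in_carrier smult_set_set_mult)
next
  fix P
  assume "P \<in> carrier (fg_submodules R M)"
  then obtain F where F: "F \<subseteq> carrier M" "P = gen F"
    by (rule fg_submodulesE)
  have "smult_set {\<one>} F = F"
    using F(1) by (force simp: smult_set_def)
  then show "\<one>\<^bsub>fg_ideals R\<^esub> \<odot>\<^bsub>fg_submodules R M\<^esub> P = P"
    using fg_submodules_smult_Idl[of "{\<one>}" F] F by (simp add: R.genideal_one)
next
  fix P
  assume "P \<in> carrier (fg_submodules R M)"
  then obtain F where F: "F \<subseteq> carrier M" "P = gen F"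
    by (rule fg_submodulesE)
  \<comment> \<open>For empty \<open>F\<close> the set of products is empty and not the singleton of
    zero, so the comparison is made between the generated submodules.\<close>
  have "gen (smult_set {\<zero>} F) \<subseteq> {\<zero>\<^bsub>M\<^esub>}"
    using F(1) by (intro gen_minimal submodule_zero) (auto simp: smult_set_def)
  moreover have "\<zero>\<^bsub>M\<^esub> \<in> gen (smult_set {\<zero>} F)"
    using F(1) by (intro submodule_zero_mem submodule_gen smult_set_in_carrier) auto
  ultimately show "\<zero>\<^bsub>fg_ideals R\<^esub> \<odot>\<^bsub>fg_submodules R M\<^esub> P = \<zero>\<^bsub>fg_submodules R M\<^esub>"
    using fg_submodules_smult_Idl[of "{\<zero>}" F] F by (auto simp: R.genideal_zero)
next
  fix I
  assume "I \<in> carrier (fg_ideals R)"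
  then show "I \<odot>\<^bsub>fg_submodules R M\<^esub> \<zero>\<^bsub>fg_submodules R M\<^esub> = \<zero>\<^bsub>fg_submodules R M\<^esub>"
    using fg_submodules_smult_Idl[of _ "{}"]
    by (elim fg_idealsE) (simp add: gen_empty smult_set_def)
qed

end

section \<open>Idempotent semimodules over the finitely generated ideals\<close>

locale idem_monoid = abelian_monoid N for N (structure) +
  assumes add_idem: "x \<in> carrier N \<Longrightarrow> x \<oplus> x = x"
begin

lemma le_refl: "x \<in> carrier N \<Longrightarrow> idem_le N x x"
  by (simp add: idem_le_def add_idem)

lemma le_zero: "x \<in> carrier N \<Longrightarrow> idem_le N \<zero> x"
  by (simp add: idem_le_def)

lemma le_antisym: "\<lbrakk>idem_le N x y; idem_le N y x; x \<in> carrier N; y \<in> carrier N\<rbrakk> \<Longrightarrow> x = y"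
  by (metis idem_le_def a_comm)

lemma le_trans:
  "\<lbrakk>idem_le N x y; idem_le N y z; x \<in> carrier N; y \<in> carrier N; z \<in> carrier N\<rbrakk> \<Longrightarrow> idem_le N x z"
  by (metis idem_le_def a_assoc)

lemma le_add1: "\<lbrakk>x \<in> carrier N; y \<in> carrier N\<rbrakk> \<Longrightarrow> idem_le N x (x \<oplus> y)"
  by (simp add: idem_le_def add_idem flip: a_assoc)

lemma le_add2: "\<lbrakk>x \<in> carrier N; y \<in> carrier N\<rbrakk> \<Longrightarrow> idem_le N y (x \<oplus> y)"
  by (metis le_add1 a_comm)

lemma add_le:
  "\<lbrakk>idem_le N x z; idem_le N y z; x \<in> carrier N; y \<in> carrier N; z \<in> carrier N\<rbrakk>
    \<Longrightarrow> idem_le N (x \<oplus> y) z"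
  by (simp add: idem_le_def a_assoc)

text \<open>Together with \<open>le_finsum\<close> this makes a finite sum the supremum of its
  terms.\<close>

lemma finsum_le:
  assumes "finite A" "f \<in> A \<rightarrow> carrier N" "z \<in> carrier N" "\<And>a. a \<in> A \<Longrightarrow> idem_le N (f a) z"
  shows "idem_le N (finsum N f A) z"
  using assms
proof (induction A rule: finite_induct)
  case (insert a A)
  then have "f a \<in> carrier N" "f \<in> A \<rightarrow> carrier N" by auto
  then show ?case using insert by (simp add: add_le)
qed (simp add: le_zero)

lemma le_finsum:
  assumes "finite A" "f \<in> A \<rightarrow> carrier N" "a \<in> A"
  shows "idem_le N (f a) (finsum N f A)"
proof -
  have "f a \<in> carrier N" "f \<in> (A - {a}) \<rightarrow> carrier N" using assms by auto
  moreover have "finsum N f (insert a (A - {a})) = f a \<oplus> finsum N f (A - {a})"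
    using assms calculation by (intro finsum_insert) auto
  ultimately show ?thesis
    using assms by (simp add: insert_absorb le_add1)
qed

text \<open>Disjointness is not assumed: both sides are suprema of the same values, and idempotence
  absorbs the terms that occur twice.\<close>

lemma finsum_Un:
  assumes "finite A" "finite B" "f \<in> A \<union> B \<rightarrow> carrier N"
  shows "finsum N f (A \<union> B) = finsum N f A \<oplus> finsum N f B"
proof (rule le_antisym)
  have f: "f \<in> A \<rightarrow> carrier N" "f \<in> B \<rightarrow> carrier N" using assms by auto
  show cl: "finsum N f (A \<union> B) \<in> carrier N" "finsum N f A \<oplus> finsum N f B \<in> carrier N"
    using f assms(3) by auto
  have "idem_le N (f x) (finsum N f A \<oplus> finsum N f B)" if "x \<in> A" for x
    using that f cl by (blast intro: le_trans[OF le_finsum[OF assms(1) f(1)] le_add1] finsum_closed)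
  moreover have "idem_le N (f x) (finsum N f A \<oplus> finsum N f B)" if "x \<in> B" for x
    using that f cl by (blast intro: le_trans[OF le_finsum[OF assms(2) f(2)] le_add2] finsum_closed)
  ultimately show "idem_le N (finsum N f (A \<union> B)) (finsum N f A \<oplus> finsum N f B)"
    using assms cl by (intro finsum_le) auto
  show "idem_le N (finsum N f A \<oplus> finsum N f B) (finsum N f (A \<union> B))"
    using assms f cl by (intro add_le finsum_le le_finsum) auto
qed

end

section \<open>Additive and subhomogeneous maps\<close>

lemma add_monoid_homsD:
  assumes "h \<in> add_monoid_homs A B"
  shows "h \<in> extensional (carrier A)" "h \<in> carrier A \<rightarrow> carrier B" "h \<zero>\<^bsub>A\<^esub> = \<zero>\<^bsub>B\<^esub>"
    "\<And>x y. \<lbrakk>x \<in> carrier A; y \<in> carrier A\<rbrakk> \<Longrightarrow> h (x \<oplus>\<^bsub>A\<^esub> y) = h x \<oplus>\<^bsub>B\<^esub> h y"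
  using assms by (auto simp: add_monoid_homs_def hom_def)

text \<open>The order is defined by an equation in the addition, which additive maps
  preserve.\<close>

lemma add_monoid_hom_mono:
  assumes "h \<in> add_monoid_homs A B" "idem_le A x y" "x \<in> carrier A" "y \<in> carrier A"
  shows "idem_le B (h x) (h y)"
  using assms add_monoid_homsD(4)[OF assms(1), of x y] by (simp add: idem_le_def)

lemma lax_semimodule_homsD:
  assumes "h \<in> lax_semimodule_homs S A B"
  shows "h \<in> add_monoid_homs A B"
    "\<And>s x. \<lbrakk>s \<in> carrier S; x \<in> carrier A\<rbrakk> \<Longrightarrow> idem_le B (h (s \<odot>\<^bsub>A\<^esub> x)) (s \<odot>\<^bsub>B\<^esub> h x)"
  using assms by (auto simp: lax_semimodule_homs_def)

lemma (in semimodule) smult_mono_right: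
  assumes "idem_le N x y" "a \<in> carrier S" "x \<in> carrier N" "y \<in> carrier N"
  shows "idem_le N (a \<odot>\<^bsub>N\<^esub> x) (a \<odot>\<^bsub>N\<^esub> y)"
  using assms smult_r_distr[of a x y] by (simp add: idem_le_def)

lemma (in semimodule) smult_mono_left:
  assumes "idem_le S a b" "a \<in> carrier S" "b \<in> carrier S" "x \<in> carrier N"
  shows "idem_le N (a \<odot>\<^bsub>N\<^esub> x) (b \<odot>\<^bsub>N\<^esub> x)"
  using assms smult_l_distr[of a b x] by (simp add: idem_le_def)

text \<open>The unit ideal satisfies R + R = R and acts as the identity, so x + x = (R + R) x = R x
  = x.\<close>

lemma (in cring) idem_monoid_semimodule:
  assumes "semimodule (fg_ideals R) N"
  shows "idem_monoid N"
proof -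
  interpret N: semimodule "fg_ideals R" N by fact
  have "carrier R <+> carrier R = carrier R"
    using idem_le_fg_ideals[OF oneideal oneideal] by (simp add: idem_le_def)
  moreover have "carrier R \<odot>\<^bsub>N\<^esub> x = x" if "x \<in> carrier N" for x
    using N.smult_one[OF that] by simp
  ultimately show ?thesis
    using N.smult_l_distr[OF one_fg_ideals one_fg_ideals] by unfold_locales simp
qed

text \<open>The chain is \<psi> (h (s x)) \<le> \<psi> (s (h x)) \<le> s (\<psi> (h x)). Its first
  inequality needs \<open>\<psi>\<close> to be monotone, which additivity provides.\<close>

lemma compose_lax_semimodule_homs:
  assumes "semimodule S A" "semimodule S B" "semimodule S C" "idem_monoid C"
    and h: "h \<in> lax_semimodule_homs S A B" and \<psi>: "\<psi> \<in> lax_semimodule_homs S B C"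
  shows "compose (carrier A) \<psi> h \<in> lax_semimodule_homs S A C"
proof -
  interpret A: semimodule S A by fact
  interpret B: semimodule S B by fact
  interpret C: semimodule S C by fact
  interpret C: idem_monoid C by fact
  note h1 = add_monoid_homsD[OF lax_semimodule_homsD(1)[OF h]]
  note \<psi>1 = add_monoid_homsD[OF lax_semimodule_homsD(1)[OF \<psi>]]
  have "compose (carrier A) \<psi> h \<in> add_monoid_homs A C"
    using h1 \<psi>1 by (auto simp: add_monoid_homs_def hom_def compose_def Pi_iff)
  moreover have "idem_le C (\<psi> (h (s \<odot>\<^bsub>A\<^esub> x))) (s \<odot>\<^bsub>C\<^esub> \<psi> (h x))"
    if "s \<in> carrier S" "x \<in> carrier A" for s x
  proof (rule C.le_trans)
    have hx: "h x \<in> carrier B" "h (s \<odot>\<^bsub>A\<^esub> x) \<in> carrier B"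
      using h1(2) that by auto
    then show "idem_le C (\<psi> (h (s \<odot>\<^bsub>A\<^esub> x))) (\<psi> (s \<odot>\<^bsub>B\<^esub> h x))"
      using add_monoid_hom_mono[OF lax_semimodule_homsD(1)[OF \<psi>] lax_semimodule_homsD(2)[OF h]]
        that by simp
    show "idem_le C (\<psi> (s \<odot>\<^bsub>B\<^esub> h x)) (s \<odot>\<^bsub>C\<^esub> \<psi> (h x))"
      using lax_semimodule_homsD(2)[OF \<psi>] that hx by simp
    show "\<psi> (h (s \<odot>\<^bsub>A\<^esub> x)) \<in> carrier C" "\<psi> (s \<odot>\<^bsub>B\<^esub> h x) \<in> carrier C"
      "s \<odot>\<^bsub>C\<^esub> \<psi> (h x) \<in> carrier C"
      using \<psi>1(2) hx that by auto
  qed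
  ultimately show ?thesis
    by (auto simp: lax_semimodule_homs_def compose_def)
qed

section \<open>Seminorms\<close>

context module
begin

text \<open>The last claim has lost the constant \<open>C\<close>: a product of ideals lies in each
  factor, so \<open>C\<close> times \<open>PIdl r\<close> lies in \<open>PIdl r\<close>, and a
  larger ideal acts with a larger result.\<close>

lemma u_seminormD:
  assumes "u_seminorm R M N w" "semimodule (fg_ideals R) N"
  shows "w \<in> carrier M \<rightarrow> carrier N" "w \<zero>\<^bsub>M\<^esub> = \<zero>\<^bsub>N\<^esub>"
    "\<And>x y. \<lbrakk>x \<in> carrier M; y \<in> carrier M\<rbrakk> \<Longrightarrow> idem_le N (w (x \<oplus>\<^bsub>M\<^esub> y)) (w x \<oplus>\<^bsub>N\<^esub> w y)"
    "\<And>r x. \<lbrakk>r \<in> carrier R; x \<in> carrier M\<rbrakk> \<Longrightarrow> idem_le N (w (r \<odot>\<^bsub>M\<^esub> x)) (PIdl r \<odot>\<^bsub>N\<^esub> w x)"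
proof -
  interpret N: semimodule "fg_ideals R" N by fact
  interpret N: idem_monoid N by (rule R.idem_monoid_semimodule) fact
  show w: "w \<in> carrier M \<rightarrow> carrier N" "w \<zero>\<^bsub>M\<^esub> = \<zero>\<^bsub>N\<^esub>"
    "\<And>x y. \<lbrakk>x \<in> carrier M; y \<in> carrier M\<rbrakk> \<Longrightarrow> idem_le N (w (x \<oplus>\<^bsub>M\<^esub> y)) (w x \<oplus>\<^bsub>N\<^esub> w y)"
    using assms(1) unfolding u_seminorm_def by auto
  obtain C where C: "C \<in> carrier (fg_ideals R)"
    "\<And>r x. \<lbrakk>r \<in> carrier R; x \<in> carrier M\<rbrakk> \<Longrightarrow>
      idem_le N (w (r \<odot>\<^bsub>M\<^esub> x)) (ideal_prod R C (PIdl r) \<odot>\<^bsub>N\<^esub> w x)"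
    using assms(1) unfolding u_seminorm_def fg_ideals_simps by blast
  show "idem_le N (w (r \<odot>\<^bsub>M\<^esub> x)) (PIdl r \<odot>\<^bsub>N\<^esub> w x)" if rx: "r \<in> carrier R" "x \<in> carrier M" for r x
  proof (rule N.le_trans[OF C(2)[OF rx]])
    have r: "PIdl r \<in> carrier (fg_ideals R)" "ideal_prod R C (PIdl r) \<in> carrier (fg_ideals R)"
      using rx C(1) by (auto intro: R.PIdl_fg_ideals R.ideal_prod_fg_ideals)
    moreover have "ideal_prod R C (PIdl r) \<subseteq> PIdl r"
      using R.ideal_prod_inter[OF C(1)[THEN R.fg_ideals_ideal] r(1)[THEN R.fg_ideals_ideal]] by simp
    moreover show "w (r \<odot>\<^bsub>M\<^esub> x) \<in> carrier N" "ideal_prod R C (PIdl r) \<odot>\<^bsub>N\<^esub> w x \<in> carrier N"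
      "PIdl r \<odot>\<^bsub>N\<^esub> w x \<in> carrier N"
      using w(1) rx r by auto
    ultimately show "idem_le N (ideal_prod R C (PIdl r) \<odot>\<^bsub>N\<^esub> w x) (PIdl r \<odot>\<^bsub>N\<^esub> w x)"
      using w(1) rx by (intro N.smult_mono_left R.idem_le_fg_ideals R.fg_ideals_ideal) auto
  qed
qed

text \<open>The witness for the constant is the unit ideal. It is neutral for the product of ideals,
  and nonzero because \<one> \<noteq> \<zero>.\<close>

lemma u_seminormI:
  assumes "\<one> \<noteq> \<zero>" "w \<in> carrier M \<rightarrow> carrier N" "w \<zero>\<^bsub>M\<^esub> = \<zero>\<^bsub>N\<^esub>"
    "\<And>x y. \<lbrakk>x \<in> carrier M; y \<in> carrier M\<rbrakk> \<Longrightarrow> idem_le N (w (x \<oplus>\<^bsub>M\<^esub> y)) (w x \<oplus>\<^bsub>N\<^esub> w y)"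
    "\<And>r x. \<lbrakk>r \<in> carrier R; x \<in> carrier M\<rbrakk> \<Longrightarrow> idem_le N (w (r \<odot>\<^bsub>M\<^esub> x)) (PIdl r \<odot>\<^bsub>N\<^esub> w x)"
  shows "u_seminorm R M N w"
proof -
  have "carrier R \<noteq> {\<zero>}"
    using assms(1) R.one_closed by blast
  moreover have "ideal_prod R (carrier R) (PIdl r) = PIdl r" if "r \<in> carrier R" for r
    using R.ideal_prod_one[OF R.cgenideal_ideal[OF that]]
      R.ideal_prod_commute[OF R.oneideal R.cgenideal_ideal[OF that]] by simp
  ultimately show ?thesis
    unfolding u_seminorm_def using assms R.one_fg_ideals
    by (intro conjI bexI[of _ "carrier R"]) auto
qed

lemma cyclic_submodule_smult:
  assumes "r \<in> carrier R" "m \<in> carrier M"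
  shows "cyclic_submodule R M (r \<odot>\<^bsub>M\<^esub> m) = PIdl r \<odot>\<^bsub>fg_submodules R M\<^esub> cyclic_submodule R M m"
proof -
  have "smult_set {r} {m} = {r \<odot>\<^bsub>M\<^esub> m}" by (auto simp: smult_set_def)
  then show ?thesis
    using assms gen_smult_set[of "{r}" "{m}"]
    by (simp add: smult_fg_submodules gen_singleton R.cgenideal_eq_genideal)
qed

text \<open>As \<open>idem_le\<close> is an equation between sums, the claim is that x + y as a
  further generator does not enlarge the submodule generated by x and y.\<close>

lemma idem_le_cyclic_add:
  assumes "x \<in> carrier M" "y \<in> carrier M"
  shows "idem_le (fg_submodules R M) (cyclic_submodule R M (x \<oplus>\<^bsub>M\<^esub> y))
    (cyclic_submodule R M x <+>\<^bsub>M\<^esub> cyclic_submodule R M y)"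
proof -
  have xy: "submodule (gen {x, y}) R M" "x \<in> gen {x, y}" "y \<in> gen {x, y}"
    using assms gen_superset[of "{x, y}"] by (auto intro: submodule_gen)
  have "gen {x \<oplus>\<^bsub>M\<^esub> y, x, y} = gen {x, y}"
  proof
    show "gen {x \<oplus>\<^bsub>M\<^esub> y, x, y} \<subseteq> gen {x, y}"
      using xy submoduleE(5)[OF xy(1)] by (intro gen_minimal) auto
    show "gen {x, y} \<subseteq> gen {x \<oplus>\<^bsub>M\<^esub> y, x, y}"
      by (intro gen_mono) auto
  qed
  then show ?thesis
    using assms gen_Un[of "{x}" "{y}"] gen_Un[of "{x \<oplus>\<^bsub>M\<^esub> y}" "{x, y}"]
    by (simp add: idem_le_def gen_singleton insert_commute)
qed

text \<open>Subhomogeneity of \<open>h\<close> at a principal ideal and a cyclic submodule is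
  exactly the seminorm inequality for scalars. The triangle inequality comes from
  \<open>idem_le_cyclic_add\<close>, since additive maps are monotone.\<close>

lemma u_seminorm_comp_cyclic:
  assumes "\<one> \<noteq> \<zero>" "h \<in> lax_semimodule_homs (fg_ideals R) (fg_submodules R M) N"
  shows "u_seminorm R M N (\<lambda>m. h (cyclic_submodule R M m))"
proof (rule u_seminormI[OF assms(1)])
  note h = lax_semimodule_homsD[OF assms(2)]
  note h1 = add_monoid_homsD[OF h(1)]
  interpret P: abelian_monoid "fg_submodules R M" by (rule abelian_monoid_fg_submodules)
  show "(\<lambda>m. h (cyclic_submodule R M m)) \<in> carrier M \<rightarrow> carrier N"
    using h1(2) cyclic_fg_submodules by auto
  show "h (cyclic_submodule R M \<zero>\<^bsub>M\<^esub>) = \<zero>\<^bsub>N\<^esub>"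
    using h1(3) by (simp add: cyclic_submodule_zero)
  show "idem_le N (h (cyclic_submodule R M (x \<oplus>\<^bsub>M\<^esub> y)))
      (h (cyclic_submodule R M x) \<oplus>\<^bsub>N\<^esub> h (cyclic_submodule R M y))"
    if "x \<in> carrier M" "y \<in> carrier M" for x y
    using add_monoid_hom_mono[OF h(1) idem_le_cyclic_add[OF that]]
      h1(4)[of "cyclic_submodule R M x" "cyclic_submodule R M y"]
      P.a_closed[of "cyclic_submodule R M x" "cyclic_submodule R M y"] that
    by (simp add: cyclic_fg_submodules)
  show "idem_le N (h (cyclic_submodule R M (r \<odot>\<^bsub>M\<^esub> x))) (PIdl r \<odot>\<^bsub>N\<^esub> h (cyclic_submodule R M x))"
    if "r \<in> carrier R" "x \<in> carrier M" for r x
    using h(2) that by (simp add: cyclic_submodule_smult cyclic_fg_submodules R.PIdl_fg_ideals)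
qed

lemma u_norm_cyclic_submodule:
  assumes "\<one> \<noteq> \<zero>"
  shows "u_norm R M (fg_submodules R M) (cyclic_submodule R M)"
proof -
  interpret P: semimodule "fg_ideals R" "fg_submodules R M" by (rule semimodule_fg_submodules)
  interpret P: idem_monoid "fg_submodules R M"
    by (rule R.idem_monoid_semimodule[OF semimodule_fg_submodules])
  have "u_seminorm R M (fg_submodules R M) (cyclic_submodule R M)"
    using idem_le_cyclic_add
    by (intro u_seminormI assms)
      (auto simp: cyclic_fg_submodules cyclic_submodule_zero cyclic_submodule_smult
        intro!: P.le_refl P.smult_closed R.PIdl_fg_ideals)
  then show ?thesis
    using mem_cyclic_submodule by (fastforce simp: u_norm_def)
qed

text \<open>This makes \<open>sn_map\<close> well defined. The constant of \<open>w\<close> is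
  removed first, so \<open>\<psi>\<close> only has to be compared with the action of
  \<open>PIdl r\<close>.\<close>

lemma u_seminorm_comp:
  assumes "\<one> \<noteq> \<zero>" "u_seminorm R M N w"
    and N: "semimodule (fg_ideals R) N" "semimodule (fg_ideals R) N'"
    and \<psi>: "\<psi> \<in> lax_semimodule_homs (fg_ideals R) N N'"
  shows "u_seminorm R M N' (\<lambda>m. \<psi> (w m))"
proof (rule u_seminormI[OF assms(1)])
  interpret N: semimodule "fg_ideals R" N by fact
  interpret N': semimodule "fg_ideals R" N' by fact
  interpret N': idem_monoid N' by (rule R.idem_monoid_semimodule) fact
  note w = u_seminormD[OF assms(2) N(1)]
  note \<psi>1 = lax_semimodule_homsD[OF \<psi>]
  note \<psi>2 = add_monoid_homsD[OF \<psi>1(1)]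
  have wc: "w m \<in> carrier N" if "m \<in> carrier M" for m
    using w(1) that by auto
  then show "(\<lambda>m. \<psi> (w m)) \<in> carrier M \<rightarrow> carrier N'"
    using \<psi>2(2) by auto
  show "\<psi> (w \<zero>\<^bsub>M\<^esub>) = \<zero>\<^bsub>N'\<^esub>"
    using \<psi>2(3) w(2) by simp
  show "idem_le N' (\<psi> (w (x \<oplus>\<^bsub>M\<^esub> y))) (\<psi> (w x) \<oplus>\<^bsub>N'\<^esub> \<psi> (w y))"
    if "x \<in> carrier M" "y \<in> carrier M" for x y
    using add_monoid_hom_mono[OF \<psi>1(1) w(3)[OF that]] \<psi>2(4)[of "w x" "w y"] wc that by simp
  show "idem_le N' (\<psi> (w (r \<odot>\<^bsub>M\<^esub> x))) (PIdl r \<odot>\<^bsub>N'\<^esub> \<psi> (w x))"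
    if rx: "r \<in> carrier R" "x \<in> carrier M" for r x
  proof (rule N'.le_trans)
    have r: "PIdl r \<in> carrier (fg_ideals R)"
      using rx by (simp add: R.PIdl_fg_ideals)
    then show "idem_le N' (\<psi> (w (r \<odot>\<^bsub>M\<^esub> x))) (\<psi> (PIdl r \<odot>\<^bsub>N\<^esub> w x))"
      using add_monoid_hom_mono[OF \<psi>1(1) w(4)[OF rx]] wc rx by simp
    show "idem_le N' (\<psi> (PIdl r \<odot>\<^bsub>N\<^esub> w x)) (PIdl r \<odot>\<^bsub>N'\<^esub> \<psi> (w x))"
      using \<psi>1(2) r wc rx by simp
    have "w (r \<odot>\<^bsub>M\<^esub> x) \<in> carrier N" "PIdl r \<odot>\<^bsub>N\<^esub> w x \<in> carrier N" "\<psi> (w x) \<in> carrier N'"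
      using wc r rx \<psi>2(2) by auto
    then show "\<psi> (w (r \<odot>\<^bsub>M\<^esub> x)) \<in> carrier N'" "\<psi> (PIdl r \<odot>\<^bsub>N\<^esub> w x) \<in> carrier N'"
      "PIdl r \<odot>\<^bsub>N'\<^esub> \<psi> (w x) \<in> carrier N'"
      using \<psi>2(2) r by auto
  qed
qed

section \<open>Unique factorization through cyclic submodules\<close>

lemma restrict_sn:
  assumes "u_seminorm R M N w"
  shows "restrict w (carrier M) \<in> sn R M N"
proof -
  have "u_seminorm R M N (restrict w (carrier M))"
    using assms unfolding u_seminorm_def by (simp add: Pi_iff)
  then show ?thesis
    by (simp add: sn_def)
qed

text \<open>Induction on a finite generating set, splitting off one cyclic summand at a time. It
  uses additivity alone, so it gives uniqueness both among monoid morphisms and among subhomogeneous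
  maps.\<close>

lemma add_monoid_homs_eqI:
  assumes g: "g \<in> add_monoid_homs (fg_submodules R M) N"
    and h: "h \<in> add_monoid_homs (fg_submodules R M) N"
    and eq: "\<And>m. m \<in> carrier M \<Longrightarrow> g (cyclic_submodule R M m) = h (cyclic_submodule R M m)"
  shows "g = h"
proof (rule extensionalityI)
  note g1 = add_monoid_homsD[OF g] and h1 = add_monoid_homsD[OF h]
  show "g \<in> extensional (carrier (fg_submodules R M))" "h \<in> extensional (carrier (fg_submodules R M))"
    using g1 h1 by auto
  have "g (gen F) = h (gen F)" if "finite F" "F \<subseteq> carrier M" for F
    using that
  proof (induction F rule: finite_induct)
    case empty
    then show ?case using g1(3) h1(3) by (simp add: gen_empty)
  next
    case (insert m F)
    then have "gen (insert m F) = cyclic_submodule R M m \<oplus>\<^bsub>fg_submodules R M\<^esub> gen F"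
      using gen_Un[of "{m}" F] by (simp add: gen_singleton)
    then show ?case
      using insert g1(4) h1(4) eq by (simp add: cyclic_fg_submodules fg_submodulesI)
  qed
  then show "g P = h P" if "P \<in> carrier (fg_submodules R M)" for P
    using that by (elim fg_submodulesE) simp
qed

text \<open>\<open>SOME\<close> picks an arbitrary finite generating set, and the sum is the
  supremum of \<open>w\<close> over it. Independence of the choice is proved in
  \<open>seminorm_ext\<close>; the restricted abstraction makes the map extensional.\<close>

definition seminorm_ext :: "('a set, 'n, 'z) module_scheme \<Rightarrow> ('c \<Rightarrow> 'n) \<Rightarrow> 'c set \<Rightarrow> 'n"
  where "seminorm_ext N w = (\<lambda>P\<in>carrier (fg_submodules R M).
    finsum N w (SOME F. finite F \<and> F \<subseteq> carrier M \<and> P = gen F))"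

text \<open>Once the choice of generators is free, each claim follows from a convenient one:
  \<open>{m}\<close> for a cyclic submodule, the union of generating sets for a sum, and
  \<open>smult_set F G\<close> for a product.\<close>

lemma seminorm_ext:
  assumes N: "semimodule (fg_ideals R) N" and w: "u_seminorm R M N w"
  shows seminorm_ext_gen:
      "\<And>F. \<lbrakk>finite F; F \<subseteq> carrier M\<rbrakk> \<Longrightarrow> seminorm_ext N w (gen F) = finsum N w F"
    and seminorm_ext_cyclic:
      "\<And>m. m \<in> carrier M \<Longrightarrow> seminorm_ext N w (cyclic_submodule R M m) = w m"
    and seminorm_ext_hom:
      "seminorm_ext N w \<in> lax_semimodule_homs (fg_ideals R) (fg_submodules R M) N"
proof -
  interpret N: semimodule "fg_ideals R" N by fact
  interpret N: idem_monoid N by (rule R.idem_monoid_semimodule) fact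
  interpret P: semimodule "fg_ideals R" "fg_submodules R M" by (rule semimodule_fg_submodules)
  note w = u_seminormD[OF w N]
  have wc: "w m \<in> carrier N" if "m \<in> carrier M" for m
    using w(1) that by auto
  have wF: "w \<in> F \<rightarrow> carrier N" if "F \<subseteq> carrier M" for F
    using that wc by blast
  have fc: "finsum N w F \<in> carrier N" if "F \<subseteq> carrier M" for F
    using wF[OF that] by (rule N.finsum_closed)
  have sublevel: "submodule {m \<in> carrier M. idem_le N (w m) n} R M" if n: "n \<in> carrier N" for n
  proof (rule submoduleI')
    show "x \<oplus>\<^bsub>M\<^esub> y \<in> {m \<in> carrier M. idem_le N (w m) n}"
      if "x \<in> {m \<in> carrier M. idem_le N (w m) n}" "y \<in> {m \<in> carrier M. idem_le N (w m) n}" for x y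
    proof -
      have xy: "x \<in> carrier M" "y \<in> carrier M" "idem_le N (w x) n" "idem_le N (w y) n"
        using that by simp_all
      then have "idem_le N (w x \<oplus>\<^bsub>N\<^esub> w y) n"
        using n wc by (simp add: N.add_le)
      then show ?thesis
        using N.le_trans[OF w(3)[OF xy(1,2)]] xy n wc by simp
    qed
    show "r \<odot>\<^bsub>M\<^esub> x \<in> {m \<in> carrier M. idem_le N (w m) n}"
      if "r \<in> carrier R" "x \<in> {m \<in> carrier M. idem_le N (w m) n}" for r x
    proof -
      have rx: "r \<in> carrier R" "x \<in> carrier M" "idem_le N (w x) n" using that by auto
      have r: "PIdl r \<in> carrier (fg_ideals R)" using rx by (simp add: R.PIdl_fg_ideals)
      have "idem_le (fg_ideals R) (PIdl r) (carrier R)"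
        using R.fg_ideals_ideal[OF r]
        by (intro R.idem_le_fg_ideals R.oneideal) (auto intro: ideal.Icarr)
      then have "idem_le N (PIdl r \<odot>\<^bsub>N\<^esub> w x) (carrier R \<odot>\<^bsub>N\<^esub> w x)"
        using r rx wc R.one_fg_ideals by (intro N.smult_mono_left) auto
      moreover have "carrier R \<odot>\<^bsub>N\<^esub> w x = w x"
        using N.smult_one[OF wc[OF rx(2)]] by simp
      ultimately have "idem_le N (w (r \<odot>\<^bsub>M\<^esub> x)) (w x)"
        using N.le_trans[OF w(4)[OF rx(1,2)]] rx r wc by simp
      then show ?thesis
        using N.le_trans[of _ "w x" n] rx n wc by simp
    qed
  qed (use n wc w(2) in \<open>auto simp: N.le_zero\<close>)
  \<comment> \<open>The sublevel submodule at the level \<open>finsum N w F\<close> contains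
    \<open>F\<close>, hence all of \<open>gen F\<close>.\<close>
  have le_gen: "idem_le N (w m) (finsum N w F)" if "finite F" "F \<subseteq> carrier M" "m \<in> gen F" for F m
  proof -
    have "F \<subseteq> {m \<in> carrier M. idem_le N (w m) (finsum N w F)}"
      using that(2) N.le_finsum[OF that(1) wF[OF that(2)]] by blast
    then show ?thesis
      using gen_minimal[OF sublevel[OF fc[OF that(2)]]] that(3) by blast
  qed
  have finsum_gen_le: "idem_le N (finsum N w F) (finsum N w G)"
    if "finite F" "F \<subseteq> carrier M" "finite G" "G \<subseteq> carrier M" "gen F = gen G" for F G
  proof (rule N.finsum_le[OF that(1) wF[OF that(2)] fc[OF that(4)]])
    show "idem_le N (w a) (finsum N w G)" if "a \<in> F" for a
      using le_gen[OF \<open>finite G\<close> \<open>G \<subseteq> carrier M\<close>, of a] gen_superset[of F] that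
        \<open>gen F = gen G\<close> by blast
  qed
  show ext: "seminorm_ext N w (gen F) = finsum N w F" if F: "finite F" "F \<subseteq> carrier M" for F
  proof -
    \<comment> \<open>\<open>G\<close> is the generating set that the definition selects for
      \<open>gen F\<close>; it may differ from \<open>F\<close>, but each of the two suprema bounds
      the other.\<close>
    define G where "G = (SOME G. finite G \<and> G \<subseteq> carrier M \<and> gen F = gen G)"
    have G: "finite G \<and> G \<subseteq> carrier M \<and> gen F = gen G"
      unfolding G_def by (rule someI[of _ F]) (use F in auto)
    have "finsum N w G = finsum N w F"
      using F G by (intro N.le_antisym finsum_gen_le fc) simp_all
    then show ?thesis
      unfolding seminorm_ext_def using F by (simp add: fg_submodulesI flip: G_def)
  qed
  show "seminorm_ext N w (cyclic_submodule R M m) = w m" if "m \<in> carrier M" for m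
    using ext[of "{m}"] that wc by (simp add: gen_singleton)
  have "seminorm_ext N w \<in> add_monoid_homs (fg_submodules R M) N"
  proof -
    have "seminorm_ext N w P \<in> carrier N" if "P \<in> carrier (fg_submodules R M)" for P
      using that by (elim fg_submodulesE) (simp add: ext fc)
    moreover have "seminorm_ext N w (P <+>\<^bsub>M\<^esub> Q) = seminorm_ext N w P \<oplus>\<^bsub>N\<^esub> seminorm_ext N w Q"
      if P: "P \<in> carrier (fg_submodules R M)" and Q: "Q \<in> carrier (fg_submodules R M)" for P Q
    proof -
      obtain F where F: "finite F" "F \<subseteq> carrier M" "P = gen F" using P by (rule fg_submodulesE)
      obtain G where G: "finite G" "G \<subseteq> carrier M" "Q = gen G" using Q by (rule fg_submodulesE)
      have "seminorm_ext N w (P <+>\<^bsub>M\<^esub> Q) = finsum N w (F \<union> G)"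
        using F G by (simp add: ext flip: gen_Un)
      also have "\<dots> = finsum N w F \<oplus>\<^bsub>N\<^esub> finsum N w G"
        using F G by (intro N.finsum_Un wF) simp_all
      finally show ?thesis
        using F G by (simp add: ext)
    qed
    moreover have "seminorm_ext N w {\<zero>\<^bsub>M\<^esub>} = \<zero>\<^bsub>N\<^esub>"
      using ext[of "{}"] by (simp add: gen_empty)
    ultimately show ?thesis
      by (auto simp: add_monoid_homs_def hom_def seminorm_ext_def)
  qed
  moreover have "idem_le N (seminorm_ext N w (I \<odot>\<^bsub>fg_submodules R M\<^esub> P)) (I \<odot>\<^bsub>N\<^esub> seminorm_ext N w P)"
    if I_fg: "I \<in> carrier (fg_ideals R)" and P_fg: "P \<in> carrier (fg_submodules R M)" for I P
  proof -
    obtain F where F: "finite F" "F \<subseteq> carrier R" "I = Idl F" using I_fg by (rule fg_idealsE)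
    obtain G where G: "finite G" "G \<subseteq> carrier M" "P = gen G" using P_fg by (rule fg_submodulesE)
    have fin: "finite (smult_set F G)" "smult_set F G \<subseteq> carrier M"
      using F G by (simp_all add: finite_smult_set smult_set_in_carrier)
    have "seminorm_ext N w (I \<odot>\<^bsub>fg_submodules R M\<^esub> P) = finsum N w (smult_set F G)"
      using F G fin by (simp add: smult_fg_submodules gen_smult_set ext)
    \<comment> \<open>Each generator z = a m of the product satisfies w z \<le> (R a) (w m) \<le> I
      (w m) \<le> I (\<open>finsum N w G\<close>). The second inequality holds because R a lies in
      I, the third because the action is monotone in the vector.\<close>
    moreover have "idem_le N (finsum N w (smult_set F G)) (I \<odot>\<^bsub>N\<^esub> finsum N w G)"
    proof (rule N.finsum_le[OF fin(1)])
      show "w \<in> smult_set F G \<rightarrow> carrier N" by (rule wF[OF fin(2)])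
      show IG: "I \<odot>\<^bsub>N\<^esub> finsum N w G \<in> carrier N" using I_fg fc[OF G(2)] by simp
      fix z assume "z \<in> smult_set F G"
      then obtain a m where am: "a \<in> F" "m \<in> G" "z = a \<odot>\<^bsub>M\<^esub> m" by (auto simp: smult_set_def)
      then have carr: "a \<in> carrier R" "m \<in> carrier M" using F G by auto
      note a = R.PIdl_fg_ideals[OF carr(1)]
      have "PIdl a \<subseteq> I"
        using R.cgenideal_minimal[OF R.fg_ideals_ideal[OF I_fg]] R.genideal_self[OF F(2)] am F by blast
      then have "idem_le N (PIdl a \<odot>\<^bsub>N\<^esub> w m) (I \<odot>\<^bsub>N\<^esub> w m)"
        using a I_fg carr wc by (intro N.smult_mono_left R.idem_le_fg_ideals R.fg_ideals_ideal) auto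
      then have "idem_le N (w z) (I \<odot>\<^bsub>N\<^esub> w m)"
        using N.le_trans[OF w(4)[OF carr]] am carr a I_fg wc by simp
      moreover have "idem_le N (I \<odot>\<^bsub>N\<^esub> w m) (I \<odot>\<^bsub>N\<^esub> finsum N w G)"
        using I_fg carr am
        by (intro N.smult_mono_right N.le_finsum[OF G(1) wF[OF G(2)]] fc[OF G(2)] wc)
      ultimately show "idem_le N (w z) (I \<odot>\<^bsub>N\<^esub> finsum N w G)"
        using N.le_trans[of "w z" "I \<odot>\<^bsub>N\<^esub> w m"] IG am carr I_fg wc by simp
    qed
    ultimately show ?thesis
      using G by (simp add: ext)
  qed
  ultimately show "seminorm_ext N w \<in> lax_semimodule_homs (fg_ideals R) (fg_submodules R M) N"
    by (auto simp: lax_semimodule_homs_def)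
qed

text \<open>The universal seminorm is \<open>cyclic_submodule R M\<close>. Injectivity is the
  uniqueness in \<open>add_monoid_homs_eqI\<close>, and \<open>seminorm_ext\<close> supplies
  preimages.\<close>

lemma bij_betw_lax_homs_sn:
  assumes "\<one> \<noteq> \<zero>" "semimodule (fg_ideals R) N"
  shows "bij_betw (\<lambda>h. compose (carrier M) h (cyclic_submodule R M))
    (lax_semimodule_homs (fg_ideals R) (fg_submodules R M) N) (sn R M N)"
proof (rule bij_betw_imageI)
  show "inj_on (\<lambda>h. compose (carrier M) h (cyclic_submodule R M))
      (lax_semimodule_homs (fg_ideals R) (fg_submodules R M) N)"
  proof (rule inj_onI)
    fix g h
    assume "g \<in> lax_semimodule_homs (fg_ideals R) (fg_submodules R M) N"
      "h \<in> lax_semimodule_homs (fg_ideals R) (fg_submodules R M) N"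
      and eq: "compose (carrier M) g (cyclic_submodule R M) =
        compose (carrier M) h (cyclic_submodule R M)"
    moreover have "g (cyclic_submodule R M m) = h (cyclic_submodule R M m)" if "m \<in> carrier M" for m
      using fun_cong[OF eq, of m] that by (simp add: compose_def)
    ultimately show "g = h"
      by (intro add_monoid_homs_eqI[of g N h]) (auto dest: lax_semimodule_homsD(1))
  qed
  show "(\<lambda>h. compose (carrier M) h (cyclic_submodule R M)) `
      lax_semimodule_homs (fg_ideals R) (fg_submodules R M) N = sn R M N" (is "?u ` ?L = _")
  proof
    show "?u ` ?L \<subseteq> sn R M N"
      using u_seminorm_comp_cyclic[OF assms(1)]
      by (auto simp: compose_def intro: restrict_sn)
    show "sn R M N \<subseteq> ?u ` ?L"
    proof
      fix w assume "w \<in> sn R M N"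
      then have w: "w \<in> extensional (carrier M)" "u_seminorm R M N w" by (auto simp: sn_def)
      have "?u (seminorm_ext N w) = w"
        by (rule extensionalityI[of _ "carrier M"])
          (use w seminorm_ext_cyclic[OF assms(2) w(2)] in \<open>auto simp: compose_def\<close>)
      then show "w \<in> ?u ` ?L"
        using seminorm_ext_hom[OF assms(2) w(2)] by (rule image_eqI[OF sym])
    qed
  qed
qed

end

text \<open>One inclusion holds because the preimage of a submodule is a submodule, the other
  because the image of a submodule is one. Finite sets \<open>A\<close> show that images of finitely
  generated submodules are finitely generated, and singletons give the compatibility with cyclic
  submodules.\<close>

lemma linear_hom_image_gen:
  assumes "module R M1" "module R M2" "f \<in> linear_homs R M1 M2" "A \<subseteq> carrier M1"
  shows "f ` gen_submodule R M1 A = gen_submodule R M2 (f ` A)"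
proof
  interpret M1: module R M1 by fact
  interpret M2: module R M2 by fact
  have f: "f \<in> carrier M1 \<rightarrow> carrier M2" "f \<zero>\<^bsub>M1\<^esub> = \<zero>\<^bsub>M2\<^esub>"
    "\<And>x y. \<lbrakk>x \<in> carrier M1; y \<in> carrier M1\<rbrakk> \<Longrightarrow> f (x \<oplus>\<^bsub>M1\<^esub> y) = f x \<oplus>\<^bsub>M2\<^esub> f y"
    "\<And>r x. \<lbrakk>r \<in> carrier R; x \<in> carrier M1\<rbrakk> \<Longrightarrow> f (r \<odot>\<^bsub>M1\<^esub> x) = r \<odot>\<^bsub>M2\<^esub> f x"
    using assms(3) add_monoid_homsD[of f M1 M2] by (auto simp: linear_homs_def)
  have fA: "f ` A \<subseteq> carrier M2" using f(1) assms(4) by auto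
  note sub2 = M2.submodule_gen[OF fA] and sub1 = M1.submodule_gen[OF assms(4)]
  have "submodule {x \<in> carrier M1. f x \<in> M2.gen (f ` A)} R M1"
    using f M2.submoduleE[OF sub2] M2.submodule_zero_mem[OF sub2]
    by (intro M1.submoduleI') auto
  moreover have "A \<subseteq> {x \<in> carrier M1. f x \<in> M2.gen (f ` A)}"
    using assms(4) M2.gen_superset[of "f ` A"] by auto
  ultimately show "f ` M1.gen A \<subseteq> M2.gen (f ` A)"
    using M1.gen_minimal by blast
  have carr: "x \<in> carrier M1" if "x \<in> M1.gen A" for x
    using M1.gen_in_carrier[OF assms(4)] that by auto
  have "submodule (f ` M1.gen A) R M2"
  proof (rule M2.submoduleI')
    show "f ` M1.gen A \<subseteq> carrier M2" using carr f(1) by auto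
    show "\<zero>\<^bsub>M2\<^esub> \<in> f ` M1.gen A"
      using imageI[OF M1.submodule_zero_mem[OF sub1], of f] f(2) by simp
    show "x \<oplus>\<^bsub>M2\<^esub> y \<in> f ` M1.gen A" if "x \<in> f ` M1.gen A" "y \<in> f ` M1.gen A" for x y
      using that M1.submoduleE(5)[OF sub1] carr by (auto simp flip: f(3))
    show "r \<odot>\<^bsub>M2\<^esub> x \<in> f ` M1.gen A" if "r \<in> carrier R" "x \<in> f ` M1.gen A" for r x
      using that M1.submoduleE(4)[OF sub1] carr by (auto simp flip: f(4))
  qed
  then show "M2.gen (f ` A) \<subseteq> f ` M1.gen A"
    using M1.gen_superset[of A] by (intro M2.gen_minimal) auto
qed

theorem proposition1:
  fixes R :: "('a, 'b) ring_scheme"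
    and M :: "('a, 'm, 'c) module_scheme"
  assumes "module R M" and "\<one>\<^bsub>R\<^esub> \<noteq> \<zero>\<^bsub>R\<^esub>"
  shows "semimodule (fg_ideals R) (fg_submodules R M) \<and>
    u_norm R M (fg_submodules R M) (cyclic_submodule R M) \<and>
    \<comment> \<open>(i)\<close>
    (\<forall>(N :: ('a set, 'n) module) w.
      semimodule (fg_ideals R) N \<and> u_seminorm R M N w \<longrightarrow>
        (\<exists>!h. h \<in> add_monoid_homs (fg_submodules R M) N \<and>
          (\<forall>m\<in>carrier M. h (cyclic_submodule R M m) = w m))) \<and>
    \<comment> \<open>(ii)\<close>
    (\<forall>(M1 :: ('a, 'm1) module) (M2 :: ('a, 'm2) module) f.
      module R M1 \<and> module R M2 \<and> f \<in> linear_homs R M1 M2 \<longrightarrow>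
        (\<forall>P\<in>carrier (fg_submodules R M1). f ` P \<in> carrier (fg_submodules R M2)) \<and>
        (\<forall>m\<in>carrier M1. cyclic_submodule R M2 (f m) = f ` cyclic_submodule R M1 m)) \<and>
    \<comment> \<open>(iii): \<open>sn\<close> is a functor,\<close>
    (\<forall>(N :: ('a set, 'n) module) (N' :: ('a set, 'n1) module) (N'' :: ('a set, 'n2) module) \<psi> \<psi>' w.
      semimodule (fg_ideals R) N \<and> semimodule (fg_ideals R) N' \<and> semimodule (fg_ideals R) N'' \<and>
      \<psi> \<in> lax_semimodule_homs (fg_ideals R) N N' \<and> \<psi>' \<in> lax_semimodule_homs (fg_ideals R) N' N'' \<and>
      w \<in> sn R M N \<longrightarrow>
        sn_map M \<psi> w \<in> sn R M N' \<and>
        sn_map M (restrict id (carrier N)) w = w \<and>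
        sn_map M (compose (carrier N) \<psi>' \<psi>) w = sn_map M \<psi>' (sn_map M \<psi> w)) \<and>
    \<comment> \<open>and composition with \<open>cyclic_submodule R M\<close> is a bijection from the morphisms
        \<open>fg_submodules R M \<rightarrow> N\<close> to \<open>sn R M N\<close> for every \<open>N\<close>,\<close>
    (\<forall>N :: ('a set, 'n) module. semimodule (fg_ideals R) N \<longrightarrow>
      bij_betw (\<lambda>h. compose (carrier M) h (cyclic_submodule R M))
        (lax_semimodule_homs (fg_ideals R) (fg_submodules R M) N) (sn R M N)) \<and>
    \<comment> \<open>natural in \<open>N\<close>\<close>
    (\<forall>(N :: ('a set, 'n) module) (N' :: ('a set, 'n1) module) \<psi> h.
      semimodule (fg_ideals R) N \<and> semimodule (fg_ideals R) N' \<and>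
      \<psi> \<in> lax_semimodule_homs (fg_ideals R) N N' \<and>
      h \<in> lax_semimodule_homs (fg_ideals R) (fg_submodules R M) N \<longrightarrow>
        compose (carrier (fg_submodules R M)) \<psi> h
          \<in> lax_semimodule_homs (fg_ideals R) (fg_submodules R M) N' \<and>
        compose (carrier M) (compose (carrier (fg_submodules R M)) \<psi> h) (cyclic_submodule R M)
          = sn_map M \<psi> (compose (carrier M) h (cyclic_submodule R M)))"
proof (intro conjI allI impI ballI)
  interpret module R M by fact
  note nz = assms(2)
  show "semimodule (fg_ideals R) (fg_submodules R M)"
    by (rule semimodule_fg_submodules)
  show "u_norm R M (fg_submodules R M) (cyclic_submodule R M)"
    by (rule u_norm_cyclic_submodule[OF nz])
  show "\<exists>!h. h \<in> add_monoid_homs (fg_submodules R M) N \<and>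
      (\<forall>m\<in>carrier M. h (cyclic_submodule R M m) = w m)"
    if "semimodule (fg_ideals R) N \<and> u_seminorm R M N w"
    for N :: "('a set, 'n) module" and w
  proof (rule ex1I[of _ "seminorm_ext N w"])
    show "seminorm_ext N w \<in> add_monoid_homs (fg_submodules R M) N \<and>
        (\<forall>m\<in>carrier M. seminorm_ext N w (cyclic_submodule R M m) = w m)"
      using that seminorm_ext_hom[THEN lax_semimodule_homsD(1)] seminorm_ext_cyclic by blast
    then show "h = seminorm_ext N w"
      if "h \<in> add_monoid_homs (fg_submodules R M) N \<and>
        (\<forall>m\<in>carrier M. h (cyclic_submodule R M m) = w m)" for h
      using that by (intro add_monoid_homs_eqI) auto
  qed
  show "bij_betw (\<lambda>h. compose (carrier M) h (cyclic_submodule R M))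
      (lax_semimodule_homs (fg_ideals R) (fg_submodules R M) N) (sn R M N)"
    if "semimodule (fg_ideals R) N" for N :: "('a set, 'n) module"
    by (rule bij_betw_lax_homs_sn[OF nz that])
  {
    fix M1 :: "('a, 'm1) module" and M2 :: "('a, 'm2) module" and f
    assume *: "module R M1 \<and> module R M2 \<and> f \<in> linear_homs R M1 M2"
    interpret M1: module R M1 using * by simp
    interpret M2: module R M2 using * by simp
    have f: "f \<in> linear_homs R M1 M2" "f \<in> carrier M1 \<rightarrow> carrier M2"
      using * add_monoid_homsD(2)[of f M1 M2] by (auto simp: linear_homs_def)
    note image = linear_hom_image_gen[OF M1.module_axioms M2.module_axioms f(1)]
    show "f ` P \<in> carrier (fg_submodules R M2)" if P: "P \<in> carrier (fg_submodules R M1)" for P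
    proof -
      obtain F where F: "finite F" "F \<subseteq> carrier M1" "P = M1.gen F"
        using P by (rule M1.fg_submodulesE)
      moreover have "f ` F \<subseteq> carrier M2" using F f by auto
      ultimately show ?thesis by (simp add: image M2.fg_submodulesI)
    qed
    show "cyclic_submodule R M2 (f m) = f ` cyclic_submodule R M1 m" if m: "m \<in> carrier M1" for m
    proof -
      have "f m \<in> carrier M2" using f m by auto
      then show ?thesis
        using image[of "{m}"] m by (simp add: M1.gen_singleton M2.gen_singleton)
    qed
  }
  {
    fix N :: "('a set, 'n) module" and N' :: "('a set, 'n1) module"
      and N'' :: "('a set, 'n2) module" and \<psi> \<psi>' w
    assume *: "semimodule (fg_ideals R) N \<and> semimodule (fg_ideals R) N' \<and>
      semimodule (fg_ideals R) N'' \<and> \<psi> \<in> lax_semimodule_homs (fg_ideals R) N N' \<and>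
      \<psi>' \<in> lax_semimodule_homs (fg_ideals R) N' N'' \<and> w \<in> sn R M N"
    have w: "w \<in> extensional (carrier M)" "u_seminorm R M N w"
      using * by (auto simp: sn_def)
    then have wc: "w \<in> carrier M \<rightarrow> carrier N"
      by (simp add: u_seminorm_def)
    show "sn_map M \<psi> w \<in> sn R M N'"
      using u_seminorm_comp[OF nz w(2)] *
      by (auto simp: sn_map_def compose_def intro: restrict_sn)
    show "sn_map M (restrict id (carrier N)) w = w"
      \<comment> \<open>Morphisms are extensional, so the identity of \<open>N\<close> is
        \<open>id\<close> restricted to its carrier; it fixes \<open>w\<close> because
        \<open>w\<close> takes its values there.\<close>
      by (rule extensionalityI[of _ "carrier M"]) (use w wc in \<open>auto simp: sn_map_def compose_def\<close>)
    show "sn_map M (compose (carrier N) \<psi>' \<psi>) w = sn_map M \<psi>' (sn_map M \<psi> w)"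
      unfolding sn_map_def using wc by (rule compose_assoc[symmetric])
  }
  {
    fix N :: "('a set, 'n) module" and N' :: "('a set, 'n1) module" and \<psi> h
    assume *: "semimodule (fg_ideals R) N \<and> semimodule (fg_ideals R) N' \<and>
      \<psi> \<in> lax_semimodule_homs (fg_ideals R) N N' \<and>
      h \<in> lax_semimodule_homs (fg_ideals R) (fg_submodules R M) N"
    show "compose (carrier (fg_submodules R M)) \<psi> h
        \<in> lax_semimodule_homs (fg_ideals R) (fg_submodules R M) N'"
      using * R.idem_monoid_semimodule
      by (intro compose_lax_semimodule_homs[of _ _ N] semimodule_fg_submodules) auto
    show "compose (carrier M) (compose (carrier (fg_submodules R M)) \<psi> h) (cyclic_submodule R M)
        = sn_map M \<psi> (compose (carrier M) h (cyclic_submodule R M))"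
      \<comment> \<open>Both transformations are compositions, so naturality is associativity of
        composition.\<close>
      unfolding sn_map_def using cyclic_fg_submodules by (intro compose_assoc[symmetric]) auto
  }
qed

end
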